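(* Let $\mathbb{F}$ be an algebraically closed field of characteristic different from $2$, and let $n,k$ be positive integers with $n \ge 2$. A map $\phi : M_n(\mathbb{F}) \to M_n(\mathbb{F})$ (no additivity, linearity, injectivity or surjectivity is assumed) satisfies $$\phi(A^k \circ B) = \phi(A)^k \circ \phi(B) \qquad \text{for all } A,B \in M_n(\mathbb{F})$$ if and only if one of the following holds: (a) $\phi$ is constant, equal to a fixed matrix $Q \in M_n(\mathbb{F})$ with $Q^{k+1}=Q$; (b) there exist an invertible matrix $T \in M_n(\mathbb{F})$, a ring monomorphism $\omega : \mathbb{F} \to \mathbb{F}$, and $\varepsilon \in \mathbb{F}$ with $\varepsilon^k = 1$ such that either $$\phi(X) = \varepsilon\, T\, \omega(X)\, T^{-1} \quad \text{for all } X \in M_n(\mathbb{F}),$$ or $$\phi(X) = \varepsilon\, T\, \omega(X)^t\, T^{-1} \quad \text{for all } X \in M_n(\mathbb{F}).$$ In particular, every nonconstant map $\phi : M_n(\mathbb{F}) \to M_n(\mathbb{F})$ satisfying $\phi(A^k \circ B) = \phi(A)^k \circ \phi(B)$ for all $A,B \in M_n(\mathbb{F})$ is additive.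
   Context: $M_n(\mathbb{F})$ is the algebra of $n\times n$ matrices over $\mathbb{F}$. The normalized Jordan product is $A \circ B := \tfrac12(AB+BA)$. For a ring endomorphism $\omega$ of $\mathbb{F}$ and $X=[x_{ij}]\in M_n(\mathbb{F})$, $\omega(X) := [\omega(x_{ij})]$ is the matrix obtained by applying $\omega$ entrywise. $(\cdot)^t$ denotes matrix transposition. *)

theory Defs
  imports "HOL-Analysis.Analysis"
begin

text \<open>
  On \<^typ>\<open>'a^'n^'n\<close> the overloaded operations \<open>*\<close> and \<open>^\<close> act componentwise, so
  powers of matrices are defined here from the matrix product \<open>**\<close>.
\<close>

primrec mat_pow :: "'a::semiring_1^'n^'n \<Rightarrow> nat \<Rightarrow> 'a^'n^'n" where
  "mat_pow A 0 = mat 1"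
| "mat_pow A (Suc m) = A ** mat_pow A m"

definition mat_smult :: "'a::times \<Rightarrow> 'a^'n^'m \<Rightarrow> 'a^'n^'m" where
  "mat_smult c A = map_matrix (\<lambda>x. c * x) A"

definition jordan_prod :: "'a::field^'n^'n \<Rightarrow> 'a^'n^'n \<Rightarrow> 'a^'n^'n" where
  "jordan_prod A B = mat_smult (1 / 2) (A ** B + B ** A)"

text \<open>
  For maps between fields, \<open>\<omega> 1 = 1\<close> already follows from injectivity and multiplicativity.
\<close>

definition ring_monomorphism :: "('a::ring_1 \<Rightarrow> 'b::ring_1) \<Rightarrow> bool" where
  "ring_monomorphism \<omega> \<longleftrightarrow>
     (\<forall>x y. \<omega> (x + y) = \<omega> x + \<omega> y) \<and> (\<forall>x y. \<omega> (x * y) = \<omega> x * \<omega> y) \<and> \<omega> 1 = 1 \<and> inj \<omega>"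

end

(*
  Write Z for the value at 0. The set of matrices sent to Z absorbs Jordan products, so if it
  contains one matrix unit E_ii it contains every diagonal idempotent and finally the identity,
  and the map is constant. Otherwise the idempotents phi(E_ii)^k - Z^k are nonzero and pairwise
  orthogonal; there are n of them, so they form a frame, Z = 0, and after a similarity
  phi(E_ii)^k = E_ii. The image of the identity commutes with phi(q)^k for every idempotent q,
  which makes it a scalar epsilon with epsilon^k = 1. Since the field is algebraically closed,
  diagonal matrices and matrices x E_ij + y E_ji with xy nonzero have k-th roots, so phi / epsilon
  preserves Jordan products with such left factors. Products with E_ii isolate entries, products
  with E_ij + E_ji move the diagonal off the diagonal and force the scalar map omega to be
  additive, and orthogonality relations between the images of x E_ij + y E_ji show that phi acts
  on each pair of positions (i,j), (j,i) either directly or by transposition, up to coefficients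
  that form a cocycle. Comparing three indices shows that the choice is uniform.
*)
theory Submission
  imports Defs
begin

section \<open>Diagonal and two-entry matrices, with entrywise product formulas\<close>

definition diag_mat :: "('n \<Rightarrow> 'a) \<Rightarrow> 'a::semiring_1^'n^'n"
  where "diag_mat d = (\<chi> a b. if a = b then d a else 0)"

text \<open>Opposite positions are kept together because a single off-diagonal matrix unit is
  nilpotent and may lack a k-th root, while \<open>off_mat i j x y\<close> with
  \<open>i \<noteq> j\<close> and nonzero \<open>x\<close>, \<open>y\<close> has one over an
  algebraically closed field of characteristic other than 2.\<close>

definition off_mat :: "'n \<Rightarrow> 'n \<Rightarrow> 'a \<Rightarrow> 'a \<Rightarrow> 'a::semiring_1^'n^'n"
  where "off_mat i j x y = (\<chi> a b. if a = i \<and> b = j then x else if a = j \<and> b = i then y else 0)"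

abbreviation unit_mat :: "'n \<Rightarrow> 'a::semiring_1^'n^'n"
  where "unit_mat i \<equiv> diag_mat (\<lambda>a. if a = i then 1 else 0)"

lemma diag_mat_nth: "diag_mat d $ a $ b = (if a = b then d a else 0)"
  by (simp add: diag_mat_def)

lemma off_mat_nth:
  "off_mat i j x y $ a $ b = (if a = i \<and> b = j then x else if a = j \<and> b = i then y else 0)"
  by (simp add: off_mat_def)

lemma mat_smult_nth [simp]: "mat_smult c A $ a $ b = c * A $ a $ b"
  by (simp add: mat_smult_def)

lemma matrix_eq_iff: "A = B \<longleftrightarrow> (\<forall>a b. A $ a $ b = B $ a $ b)"
  by (simp add: vec_eq_iff)

lemma matrix_mult_nth: "(A ** B) $ a $ b = (\<Sum>c\<in>UNIV. A $ a $ c * B $ c $ b)"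
  by (simp add: matrix_matrix_mult_def)

lemma diag_mat_mult_nth: "(diag_mat d ** X) $ a $ b = d a * X $ a $ b"
  by (simp add: matrix_mult_nth diag_mat_nth if_distrib if_distribR sum.delta' cong: if_cong)

lemma mult_diag_mat_nth: "(X ** diag_mat d) $ a $ b = X $ a $ b * d b"
  by (simp add: matrix_mult_nth diag_mat_nth if_distrib if_distribR sum.delta cong: if_cong)

lemma off_mat_mult_nth:
  assumes "i \<noteq> j"
  shows "(off_mat i j x y ** X) $ a $ b =
    (if a = i then x * X $ j $ b else if a = j then y * X $ i $ b else 0)"
proof -
  have "off_mat i j x y $ a $ c * X $ c $ b =
     (if c = j then (if a = i then x * X $ j $ b else 0) else 0) +
     (if c = i then (if a = j then y * X $ i $ b else 0) else 0)" for c
    using assms by (auto simp: off_mat_nth)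
  then show ?thesis
    using assms by (simp add: matrix_mult_nth sum.distrib)
qed

lemma mult_off_mat_nth:
  assumes "i \<noteq> j"
  shows "(X ** off_mat i j x y) $ a $ b =
    (if b = j then X $ a $ i * x else if b = i then X $ a $ j * y else 0)"
proof -
  have "X $ a $ c * off_mat i j x y $ c $ b =
     (if c = i then (if b = j then X $ a $ i * x else 0) else 0) +
     (if c = j then (if b = i then X $ a $ j * y else 0) else 0)" for c
    using assms by (auto simp: off_mat_nth)
  then show ?thesis
    using assms by (simp add: matrix_mult_nth sum.distrib)
qed

lemma jordan_prod_nth:
  "jordan_prod A B $ a $ b = ((A ** B) $ a $ b + (B ** A) $ a $ b) / 2"
  by (simp add: jordan_prod_def)

lemma jordan_diag_mat_nth:
  "jordan_prod (diag_mat d) X $ a $ b = (d a + d b) * X $ a $ b / 2"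
  by (simp add: jordan_prod_nth diag_mat_mult_nth mult_diag_mat_nth algebra_simps)

lemma jordan_off_mat_nth:
  assumes "i \<noteq> j"
  shows "jordan_prod (off_mat i j x y) X $ a $ b =
    ((if a = i then x * X $ j $ b else if a = j then y * X $ i $ b else 0) +
     (if b = j then X $ a $ i * x else if b = i then X $ a $ j * y else 0)) / 2"
  using assms by (simp add: jordan_prod_nth off_mat_mult_nth mult_off_mat_nth)

lemma other_index:
  assumes "2 \<le> CARD('n)"
  shows "\<exists>j::'n::finite. j \<noteq> i"
proof (rule ccontr)
  assume "\<nexists>j. j \<noteq> i"
  then have "(UNIV::'n set) = {i}" by auto
  then have "CARD('n) = 1" by (metis card_1_singleton_iff One_nat_def)
  then show False using assms by simp
qed

section \<open>Scalar multiples, matrix powers and Jordan products, also under similarity\<close>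

lemma mat_smult_add: "mat_smult c (A + B) = mat_smult c A + mat_smult (c::'a::semiring_1) B"
  by (simp add: matrix_eq_iff distrib_left)

lemma mat_smult_add_left: "mat_smult (c + d) A = mat_smult c A + mat_smult (d::'a::semiring_1) A"
  by (simp add: matrix_eq_iff distrib_right)

lemma mat_smult_smult: "mat_smult c (mat_smult d A) = mat_smult (c * (d::'a::semiring_1)) A"
  by (simp add: matrix_eq_iff mult.assoc)

lemma mat_smult_1 [simp]: "mat_smult (1::'a::semiring_1) A = A"
  by (simp add: matrix_eq_iff)

lemma mat_smult_0 [simp]: "mat_smult c 0 = (0::'a::semiring_1^'n^'m)"
  by (simp add: matrix_eq_iff)

lemma mat_smult_mult: "mat_smult c A ** B = mat_smult (c::'a::semiring_1) (A ** B)"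
  by (simp add: matrix_eq_iff matrix_mult_nth sum_distrib_left mult.assoc)

lemma mult_mat_smult: "A ** mat_smult c B = mat_smult (c::'a::comm_semiring_1) (A ** B)"
  by (simp add: matrix_eq_iff matrix_mult_nth sum_distrib_left mult.left_commute)

lemma matrix_mult_add_rdistrib: "(A + B) ** C = A ** C + B ** (C::'a::semiring_1^'n^'m)"
  by (simp add: matrix_eq_iff matrix_mult_nth sum.distrib distrib_right)

lemma matrix_mult_diff_rdistrib: "(A - B) ** C = A ** C - B ** (C::'a::ring_1^'n^'m)"
  by (simp add: matrix_eq_iff matrix_mult_nth sum_subtractf left_diff_distrib)

lemma matrix_mult_diff_ldistrib: "A ** (B - C) = A ** B - A ** (C::'a::ring_1^'n^'m)"
  by (simp add: matrix_eq_iff matrix_mult_nth sum_subtractf right_diff_distrib)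

lemma matrix_mult_0 [simp]: "A ** 0 = (0::'a::semiring_1^'n^'m)" "0 ** B = (0::'a::semiring_1^'n^'m)"
  by (simp_all add: matrix_eq_iff matrix_mult_nth)

lemma mat_pow_commute_matrix:
  assumes "A ** B = B ** A"
  shows "mat_pow A m ** B = B ** mat_pow A m"
  by (induction m) (simp_all, metis assms matrix_mul_assoc)

lemma mat_pow_Suc_right: "mat_pow A (Suc m) = mat_pow A m ** A"
  by (simp add: mat_pow_commute_matrix)

lemma mat_pow_mat_0: "0 < m \<Longrightarrow> mat_pow 0 m = 0"
  by (cases m) simp_all

lemma mat_pow_idempotent:
  assumes "A ** A = A" "0 < m"
  shows "mat_pow A m = A"
  using assms(2)
proof (induction m)
  case (Suc m)
  then show ?case using assms(1) by (cases m) simp_all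
qed simp

lemma mat_pow_mat_smult:
  "mat_pow (mat_smult c A) m = mat_smult ((c::'a::comm_semiring_1) ^ m) (mat_pow A m)"
  by (induction m) (simp_all add: mat_smult_mult mult_mat_smult mat_smult_smult mult.commute)

lemma mat_pow_similar:
  assumes "T ** T' = mat 1" "T' ** T = mat 1"
  shows "mat_pow (T' ** A ** T) m = T' ** mat_pow A m ** T"
proof (induction m)
  case (Suc m)
  have "mat_pow (T' ** A ** T) (Suc m) = T' ** A ** (T ** T') ** mat_pow A m ** T"
    by (simp add: Suc matrix_mul_assoc)
  then show ?case by (simp add: assms matrix_mul_assoc)
qed (simp add: assms)

lemma mat_pow_diag_mat: "mat_pow (diag_mat d) m = diag_mat (\<lambda>a. d a ^ m)"
  by (induction m) (auto simp: matrix_eq_iff diag_mat_mult_nth diag_mat_nth mat_def)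

lemma jordan_prod_mat_1:
  assumes "(2::'a::field) \<noteq> 0"
  shows "jordan_prod (mat 1) B = (B::'a^'n^'n)" "jordan_prod B (mat 1) = B"
  using assms by (simp_all add: matrix_eq_iff jordan_prod_nth)

lemma jordan_prod_0 [simp]: "jordan_prod 0 B = 0" "jordan_prod B 0 = 0"
  by (simp_all add: jordan_prod_def)

lemma jordan_prod_mat_smult:
  "jordan_prod (mat_smult c A) B = mat_smult c (jordan_prod A B)"
  "jordan_prod A (mat_smult c B) = mat_smult c (jordan_prod A B)"
  by (simp_all add: jordan_prod_def mat_smult_mult mult_mat_smult mat_smult_smult mult.commute flip: mat_smult_add)

lemma jordan_prod_self:
  assumes "(2::'a::field) \<noteq> 0"
  shows "jordan_prod A A = A ** (A::'a^'n^'n)"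
  using assms by (simp add: matrix_eq_iff jordan_prod_nth)

lemma jordan_prod_similar:
  assumes "T ** T' = mat 1"
  shows "jordan_prod (T' ** A ** T) (T' ** B ** T) = T' ** jordan_prod A B ** (T::'a::field^'n^'n)"
proof -
  have "T' ** X ** T ** (T' ** Y ** T) = T' ** (X ** Y) ** T" for X Y
  proof -
    have "T' ** X ** T ** (T' ** Y ** T) = T' ** X ** (T ** T') ** Y ** T"
      by (simp add: matrix_mul_assoc)
    then show ?thesis by (simp add: assms matrix_mul_assoc)
  qed
  then show ?thesis
    by (simp add: jordan_prod_def mult_mat_smult mat_smult_mult matrix_add_ldistrib matrix_mult_add_rdistrib)
qed

text \<open>Multiplying \<open>F ** X + X ** F = Z + Z\<close> by \<open>F\<close> on the left and
  on the right shows that both one-sided products equal \<open>F ** X ** F\<close>; they therefore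
  coincide, and 2 can be cancelled. \<open>Z\<close> stays general because the lemma is applied with
  \<open>Z\<close> equal to 0, to the value at 0, and to the image of an idempotent.\<close>

lemma peirce:
  assumes "(2::'a::field) \<noteq> 0" and F: "F ** F = (F::'a^'n^'n)"
    and Z: "F ** Z = Z" "Z ** F = Z" and FX: "jordan_prod F X = Z"
  shows "F ** X = Z" "X ** F = Z"
proof -
  have dbl: "A = B" if "A + A = B + B" for A B :: "'a^'n^'n"
  proof -
    have "2 * A $ a $ b = 2 * B $ a $ b" for a b
      using arg_cong[OF that, of "\<lambda>M. M $ a $ b"] by (simp only: mult_2 vector_add_component)
    then show ?thesis using assms(1) by (simp add: matrix_eq_iff)
  qed
  have 1: "F ** X + X ** F = Z + Z"
  proof -
    have "mat_smult 2 (jordan_prod F X) = F ** X + X ** F"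
      using assms(1) by (simp add: jordan_prod_def mat_smult_smult)
    then show ?thesis using mat_smult_add_left[of 1 1 Z] by (simp add: FX)
  qed
  have 2: "F ** X + F ** X ** F = Z + Z"
    using arg_cong[OF 1, of "\<lambda>M. F ** M"] by (simp only: matrix_add_ldistrib matrix_mul_assoc F Z)
  have "F ** X ** F + X ** F ** F = Z + Z"
    using arg_cong[OF 1, of "\<lambda>M. M ** F"] by (simp only: matrix_mult_add_rdistrib Z)
  moreover have "X ** F ** F = X ** F" by (simp only: F flip: matrix_mul_assoc)
  ultimately have 3: "F ** X ** F + X ** F = Z + Z" by simp
  from 1 2 have "X ** F = F ** X ** F" by (metis add_left_cancel)
  moreover from 1 3 have "F ** X = F ** X ** F" by (metis add_right_cancel)
  ultimately have eq: "X ** F = F ** X" by simp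
  with 1 show "F ** X = Z" using dbl by simp
  with eq show "X ** F = Z" by simp
qed

section \<open>Existence of k-th roots of matrices\<close>

lemma mat_pow_two_idempotents:
  fixes p q :: "'a::field^'n^'n"
  assumes "p ** p = p" "q ** q = q" "p ** q = 0" "q ** p = 0" "0 < m"
  shows "mat_pow (mat_smult c p + mat_smult d q) m = mat_smult (c ^ m) p + mat_smult (d ^ m) q"
  using \<open>0 < m\<close>
proof (induction m rule: nat_induct_non_zero)
  case (Suc m)
  then show ?case
    by (simp add: matrix_add_ldistrib matrix_mult_add_rdistrib mat_smult_mult mult_mat_smult
        mat_smult_smult assms mult.commute)
qed simp

text \<open>Such a matrix is diagonalizable with eigenvalues among \<open>c\<close>, \<open>-c\<close> and \<open>0\<close>;
  \<open>p\<close> and \<open>q\<close> in the proof are the spectral projections for \<open>\<plusminus>c\<close>.\<close>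

lemma mat_root_exists:
  fixes A :: "'a::alg_closed_field^'n^'n"
  assumes two: "(2::'a) \<noteq> 0" and "c \<noteq> 0" and cube: "A ** A ** A = mat_smult (c * c) A" and "0 < m"
  shows "\<exists>R. mat_pow R m = A"
proof -
  \<comment> \<open>\<open>e\<close> normalises interpolation polynomials: (t^2 + c t) / (2 c^2) is
    1 at t = c and vanishes at t = -c and t = 0; changing the sign of the linear term gives
    \<open>q\<close>.\<close>
  define e where "e = 1 / (2 * c * c)"
  define p where "p = mat_smult e (A ** A + mat_smult c A)"
  define q where "q = mat_smult e (A ** A + mat_smult (- c) A)"
  have c4: "A ** A ** (A ** A) = mat_smult (c * c) (A ** A)"
    by (simp add: matrix_mul_assoc cube mat_smult_mult)
  have c3: "A ** (A ** A) = mat_smult (c * c) A" by (simp add: matrix_mul_assoc cube)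
  have e: "e * (2 * c * c) = 1" using two \<open>c \<noteq> 0\<close> by (simp add: e_def)
  note expand = matrix_add_ldistrib matrix_mult_add_rdistrib mat_smult_mult mult_mat_smult
    mat_smult_smult c3 c4 cube mat_smult_add
  have pp: "p ** p = p"
    unfolding p_def expand by (simp add: matrix_eq_iff) (use e in algebra)
  have qq: "q ** q = q"
    unfolding q_def expand by (simp add: matrix_eq_iff) (use e in algebra)
  have pq: "p ** q = 0" "q ** p = 0"
    unfolding p_def q_def expand by (simp_all add: matrix_eq_iff algebra_simps)
  have A: "mat_smult c p + mat_smult (- c) q = A"
    unfolding p_def q_def expand by (simp add: matrix_eq_iff) (use e in algebra)
  obtain x y where "x ^ m = c" "y ^ m = - c"
    using nth_root_exists[OF \<open>0 < m\<close>] by metis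
  then have "mat_pow (mat_smult x p + mat_smult y q) m = A"
    using mat_pow_two_idempotents[OF pp qq pq \<open>0 < m\<close>, of x y] A by simp
  then show ?thesis by blast
qed

lemma diag_mat_root_exists:
  fixes d :: "'n::finite \<Rightarrow> 'a::alg_closed_field"
  assumes "0 < m"
  shows "\<exists>R. mat_pow R m = diag_mat d"
proof -
  have "\<forall>a. \<exists>x. x ^ m = d a" using nth_root_exists[OF assms] by metis
  then obtain r where "\<And>a. r a ^ m = d a" by metis
  then show ?thesis using mat_pow_diag_mat[of r m] by auto
qed

text \<open>The square of this matrix is \<open>x * y\<close> times the projection onto the
  coordinates \<open>i\<close> and \<open>j\<close>, so \<open>mat_root_exists\<close> applies with
  \<open>c\<close> a square root of \<open>x * y\<close>.\<close>

lemma off_mat_root_exists: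
  fixes x y :: "'a::alg_closed_field"
  assumes two: "(2::'a) \<noteq> 0" and "i \<noteq> j" "x \<noteq> 0" "y \<noteq> 0" and "0 < m"
  shows "\<exists>R. mat_pow R m = off_mat i j x y"
proof -
  obtain c where c: "c ^ 2 = x * y" using nth_root_exists[of 2 "x * y"] by auto
  have "off_mat i j x y ** off_mat i j x y ** off_mat i j x y = mat_smult (c * c) (off_mat i j x y)"
    using \<open>i \<noteq> j\<close> c by (auto simp: matrix_eq_iff off_mat_mult_nth mult_off_mat_nth off_mat_nth power2_eq_square)
  moreover have "c \<noteq> 0" using c assms by auto
  ultimately show ?thesis using mat_root_exists[OF two _ _ \<open>0 < m\<close>] by blast
qed

text \<open>A nonzero vector is chosen in the range of each \<open>R i\<close>. Orthogonality makes
  these vectors independent, and there are as many as the dimension, so they form the columns of an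
  invertible \<open>T\<close>.\<close>

lemma orthogonal_idempotents_diagonalize:
  fixes R :: "'n::finite \<Rightarrow> 'a::field^'n^'n"
  assumes idem: "\<And>i. R i ** R i = R i" and nz: "\<And>i. R i \<noteq> 0"
    and orth: "\<And>i j. i \<noteq> j \<Longrightarrow> R i ** R j = 0"
  obtains T T' where "T ** T' = mat 1" "T' ** T = mat 1" "\<And>i. R i ** T = T ** unit_mat i"
proof -
  have "\<exists>v. R i *v v \<noteq> 0" for i
    using nz[of i] by (metis matrix_vector_mult_0 matrix_eq)
  then obtain w where w: "\<And>i. R i *v w i \<noteq> 0" by metis
  define v where "v i = R i *v w i" for i
  have v0: "v i \<noteq> 0" for i using w by (simp add: v_def)
  have Rv: "R i *v v j = (if i = j then v j else 0)" for i j
    by (simp add: v_def matrix_vector_mul_assoc idem orth)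
  define T :: "'a^'n^'n" where "T = (\<chi> a b. v b $ a)"
  have RT: "R i ** T = T ** unit_mat i" for i
  proof -
    have "(R i ** T) $ a $ b = (R i *v v b) $ a" for a b
      by (simp add: T_def matrix_mult_nth matrix_vector_mult_def)
    then show ?thesis by (simp add: matrix_eq_iff mult_diag_mat_nth Rv) (simp add: T_def)
  qed
  \<comment> \<open>Applying \<open>R i\<close> to \<open>T *v x = 0\<close> isolates one column:
    \<open>x $ i\<close> times \<open>v i\<close> is zero, and \<open>v i\<close> is not.\<close>
  have ker: "x = 0" if "T *v x = 0" for x
  proof -
    have "x $ i = 0" for i
    proof -
      have "T *v (unit_mat i *v x) = 0"
        using that by (metis matrix_vector_mul_assoc RT matrix_vector_mult_0_right)
      moreover have "v i $ a * x $ i = (T *v (unit_mat i *v x)) $ a" for a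
      proof -
        have "(unit_mat i *v x) $ c = (if c = i then x $ i else 0)" for c
        proof -
          have "(\<Sum>d\<in>UNIV. (if c = d then if c = i then 1 else 0 else 0) * x $ d) =
            (\<Sum>d\<in>UNIV. if d = c then (if c = i then x $ i else 0) else 0)"
            by (rule sum.cong) auto
          then show ?thesis by (simp add: matrix_vector_mult_def diag_mat_nth)
        qed
        then have "(T *v (unit_mat i *v x)) $ a = (\<Sum>c\<in>UNIV. v c $ a * (if c = i then x $ i else 0))"
          by (simp add: matrix_vector_mult_def T_def)
        also have "\<dots> = (\<Sum>c\<in>UNIV. if c = i then v i $ a * x $ i else 0)"
          by (rule sum.cong) auto
        finally show ?thesis by simp
      qed
      ultimately have "v i $ a * x $ i = 0" for a by (simp only: zero_index)
      moreover obtain a where "v i $ a \<noteq> 0" using v0[of i] by (auto simp: vec_eq_iff)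
      ultimately show ?thesis by (metis mult_eq_0_iff)
    qed
    then show ?thesis by (simp add: vec_eq_iff)
  qed
  then have "\<forall>x. T *v x = 0 \<longrightarrow> x = 0" by (intro allI impI)
  then have "\<exists>T'. T' ** T = mat 1" by (simp only: matrix_left_invertible_ker)
  then obtain T' where T': "T' ** T = mat 1" by (rule exE)
  then have "T ** T' = mat 1" by (simp only: matrix_left_right_inverse)
  from that[OF this T' RT] show ?thesis .
qed

section \<open>Unital maps\<close>

text \<open>The left factors are restricted to matrices that have k-th roots over an algebraically
  closed field. With such roots at hand the exponent drops out, and neither \<open>k\<close> nor
  algebraic closedness enters this part.\<close>

locale unital_jordan_map =
  fixes \<phi> :: "'a::field^'n^'n \<Rightarrow> 'a^'n^'n"
  assumes two_neq_0: "(2::'a) \<noteq> 0"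
    and card_ge_2: "2 \<le> CARD('n)"
    and diag: "\<And>d X. \<phi> (jordan_prod (diag_mat d) X) = jordan_prod (\<phi> (diag_mat d)) (\<phi> X)"
    and off: "\<And>i j x y X. i \<noteq> j \<Longrightarrow> x \<noteq> 0 \<Longrightarrow> y \<noteq> 0 \<Longrightarrow>
      \<phi> (jordan_prod (off_mat i j x y) X) = jordan_prod (\<phi> (off_mat i j x y)) (\<phi> X)"
    and unit: "\<And>i. \<phi> (unit_mat i) = unit_mat i"
begin

section \<open>Isolating entries, and images of diagonal matrices\<close>

lemma four_neq_0: "(4::'a) \<noteq> 0"
proof -
  have "(4::'a) = 2 * 2" by simp
  then show ?thesis using two_neq_0 by (metis mult_eq_0_iff)
qed

text \<open>Since \<open>unit_mat i\<close> is fixed, the image is scaled just as \<open>X\<close>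
  is: by 1 at \<open>(i, i)\<close>, by 1/2 on the rest of row and column \<open>i\<close>, and by 0
  elsewhere.\<close>

lemma unit_nth:
  "\<phi> (jordan_prod (unit_mat i) X) $ a $ b =
    ((if a = i then 1 else 0) + (if b = i then 1 else 0)) * \<phi> X $ a $ b / 2"
  by (subst diag) (simp add: unit jordan_diag_mat_nth)

lemma zero: "\<phi> 0 = 0"
proof -
  obtain i j :: 'n where ij: "j \<noteq> i" using other_index[OF card_ge_2] by blast
  have "jordan_prod (unit_mat i) (unit_mat j) = (0::'a^'n^'n)"
    using ij by (auto simp: matrix_eq_iff jordan_diag_mat_nth diag_mat_nth)
  moreover have "\<phi> (jordan_prod (unit_mat i) (unit_mat j)) = jordan_prod (unit_mat i) (unit_mat j)"
    by (simp add: diag unit)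
  ultimately show ?thesis by simp
qed

definition diag_coeff :: "'n \<Rightarrow> 'a \<Rightarrow> 'a" where
  "diag_coeff i c = \<phi> (diag_mat (\<lambda>a. if a = i then c else 0)) $ i $ i"

lemma half_half: "x / 2 + x / 2 = (x::'a)"
  using two_neq_0 by (simp add: field_simps)

text \<open>The product of \<open>unit_mat a\<close> with \<open>diag_mat d\<close> keeps only the
  entry \<open>d a\<close>, and a second product with \<open>unit_mat a\<close> changes nothing. On
  the image side the second product halves the other entries of row \<open>a\<close>, so these
  vanish.\<close>

lemma diag_image: "\<phi> (diag_mat d) = diag_mat (\<lambda>a. diag_coeff a (d a))"
proof -
  have "\<phi> (diag_mat d) $ a $ b = (if a = b then diag_coeff a (d a) else 0)" for a b
  proof -
    have 1: "jordan_prod (unit_mat a) (diag_mat d) = diag_mat (\<lambda>b. if b = a then d a else 0)"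
      using two_neq_0 by (auto simp: matrix_eq_iff jordan_diag_mat_nth diag_mat_nth)
    have 2: "jordan_prod (unit_mat a) (diag_mat (\<lambda>b. if b = a then d a else 0)) = diag_mat (\<lambda>b. if b = a then d a else 0)"
      using two_neq_0 by (auto simp: matrix_eq_iff jordan_diag_mat_nth diag_mat_nth)
    define Y where "Y = \<phi> (diag_mat (\<lambda>b. if b = a then d a else 0))"
    have Y1: "Y $ a $ c = (1 + (if c = a then 1 else 0)) * \<phi> (diag_mat d) $ a $ c / 2" for c
      using unit_nth[of a "diag_mat d" a c] 1 by (simp add: Y_def)
    have Y2: "Y $ a $ c = (1 + (if c = a then 1 else 0)) * Y $ a $ c / 2" for c
      using unit_nth[of a "diag_mat (\<lambda>b. if b = a then d a else 0)" a c] 2 by (simp add: Y_def)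
    show ?thesis
    proof (cases "a = b")
      case True
      have "diag_coeff a (d a) = Y $ a $ a" by (simp add: Y_def diag_coeff_def)
      then show ?thesis using Y1[of a] True two_neq_0 by simp
    next
      case False
      then have "Y $ a $ b = Y $ a $ b / 2" using Y2[of b] by simp
      then have "Y $ a $ b = 0" using half_half[of "Y $ a $ b"] by (metis add_cancel_right_right)
      then show ?thesis using Y1[of b] False two_neq_0 by simp
    qed
  qed
  then show ?thesis by (simp add: matrix_eq_iff diag_mat_nth)
qed

lemma diag_coeff_1: "diag_coeff i 1 = 1"
  using unit[of i] by (simp add: diag_coeff_def diag_mat_nth)

lemma diag_coeff_0: "diag_coeff i 0 = 0"
proof -
  have "diag_mat (\<lambda>a. if a = i then (0::'a) else 0) = 0"
    by (simp add: matrix_eq_iff diag_mat_nth)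
  then show ?thesis by (simp add: diag_coeff_def zero del: if_cancel)
qed

lemma diag_coeff_mult: "diag_coeff i (x * y) = diag_coeff i x * diag_coeff i y"
proof -
  have "jordan_prod (diag_mat (\<lambda>a. x)) (diag_mat (\<lambda>a. y)) = (diag_mat (\<lambda>a. x * y) :: 'a^'n^'n)"
    using two_neq_0 by (auto simp: matrix_eq_iff jordan_diag_mat_nth diag_mat_nth)
  then have "\<phi> (diag_mat (\<lambda>a. x * y)) = jordan_prod (\<phi> (diag_mat (\<lambda>a. x))) (\<phi> (diag_mat (\<lambda>a. y)))"
    by (simp only: diag[symmetric])
  then have "diag_mat (\<lambda>a. diag_coeff a (x * y)) = jordan_prod (diag_mat (\<lambda>a. diag_coeff a x)) (diag_mat (\<lambda>a. diag_coeff a y))"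
    by (simp only: diag_image)
  then have "diag_mat (\<lambda>a. diag_coeff a (x * y)) $ i $ i = jordan_prod (diag_mat (\<lambda>a. diag_coeff a x)) (diag_mat (\<lambda>a. diag_coeff a y)) $ i $ i"
    by simp
  then have "diag_coeff i (x * y) = (2 * diag_coeff i x) * diag_coeff i y / 2"
    by (simp only: jordan_diag_mat_nth diag_mat_nth mult_2 if_True simp_thms)
  then show ?thesis using two_neq_0 by simp
qed

lemma diag_nth: "\<phi> (jordan_prod (diag_mat d) X) $ a $ b = (diag_coeff a (d a) + diag_coeff b (d b)) * \<phi> X $ a $ b / 2"
  by (simp add: diag diag_image jordan_diag_mat_nth)

text \<open>Multiplying by \<open>unit_mat j\<close> and then by \<open>unit_mat i\<close> keeps
  only the positions \<open>(i, j)\<close> and \<open>(j, i)\<close> and halves them twice. The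
  quarters remain until \<omega> is known to fix 4.\<close>

lemma off_image_quarter:
  assumes ij: "i \<noteq> j"
  shows "\<phi> (off_mat i j (X $ i $ j / 4) (X $ j $ i / 4)) = off_mat i j (\<phi> X $ i $ j / 4) (\<phi> X $ j $ i / 4)"
proof -
  have "off_mat i j (X $ i $ j / 4) (X $ j $ i / 4) = jordan_prod (unit_mat i) (jordan_prod (unit_mat j) X)"
    using ij two_neq_0 by (auto simp: matrix_eq_iff jordan_diag_mat_nth off_mat_nth)
  moreover have "off_mat i j (\<phi> X $ i $ j / 4) (\<phi> X $ j $ i / 4) = jordan_prod (unit_mat i) (jordan_prod (unit_mat j) (\<phi> X))"
    using ij two_neq_0 by (auto simp: matrix_eq_iff jordan_diag_mat_nth off_mat_nth)
  ultimately show ?thesis by (simp add: diag unit)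
qed

lemma off_shape:
  assumes ij: "i \<noteq> j"
  shows "\<phi> (off_mat i j x y) = off_mat i j (\<phi> (off_mat i j x y) $ i $ j) (\<phi> (off_mat i j x y) $ j $ i)"
proof -
  \<comment> \<open>The factors 4 undo the two halvings.\<close>
  obtain u v where "\<phi> (off_mat i j x y) = off_mat i j u v"
    using off_image_quarter[OF ij, of "off_mat i j (4*x) (4*y)"] ij four_neq_0
    by (auto simp: off_mat_nth)
  then show ?thesis using ij by (simp add: off_mat_nth)
qed

section \<open>Off-diagonal coefficients and the scalar map\<close>

definition off_coeff :: "'n \<Rightarrow> 'n \<Rightarrow> 'a" where "off_coeff i j = \<phi> (off_mat i j 1 1) $ i $ j"

lemma off_commute: "i \<noteq> j \<Longrightarrow> off_mat i j x y = off_mat j i y x"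
  by (auto simp: matrix_eq_iff off_mat_nth)

text \<open>The square of \<open>off_mat i j 1 1\<close> is a diagonal idempotent with entry 1 at
  \<open>(i, i)\<close>, and \<open>diag_image\<close> gives 1 there for its image as well.\<close>

lemma off_coeff_inverse:
  assumes ij: "i \<noteq> j"
  shows "off_coeff i j * off_coeff j i = 1"
proof -
  let ?S = "off_mat i j 1 1 :: 'a^'n^'n"
  have S: "\<phi> ?S = off_mat i j (off_coeff i j) (off_coeff j i)"
    using off_shape[OF ij, of 1 1] off_commute[OF ij, of "1::'a" 1] by (simp add: off_coeff_def)
  have 1: "jordan_prod ?S ?S = diag_mat (\<lambda>a. if a = i \<or> a = j then 1 else 0)"
    using ij two_neq_0 by (auto simp: matrix_eq_iff jordan_off_mat_nth off_mat_nth diag_mat_nth)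
  have "\<phi> (jordan_prod ?S ?S) $ i $ i = 1"
    unfolding 1 by (simp add: diag_image diag_mat_nth diag_coeff_1)
  moreover have "\<phi> (jordan_prod ?S ?S) = jordan_prod (\<phi> ?S) (\<phi> ?S)"
    using off[OF ij, of 1 1] by simp
  ultimately show ?thesis
    using ij two_neq_0 by (simp add: S jordan_off_mat_nth off_mat_nth algebra_simps)
qed

lemma off_coeff_nonzero: "i \<noteq> j \<Longrightarrow> off_coeff i j \<noteq> 0"
  using off_coeff_inverse by force

lemma diag_coeff_half:
  assumes ij: "i \<noteq> j"
  shows "\<phi> (off_mat i j (c / 2) (c / 2)) $ i $ j = diag_coeff i c * off_coeff i j / 2"
proof -
  have "off_mat i j (c / 2) (c / 2) = jordan_prod (diag_mat (\<lambda>a. if a = i then c else 0)) (off_mat i j 1 1)"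
    using ij by (auto simp: matrix_eq_iff jordan_diag_mat_nth off_mat_nth)
  then show ?thesis using ij by (simp add: diag_nth off_coeff_def diag_coeff_0)
qed

text \<open>Placing \<open>c\<close> at position \<open>i\<close> or at position \<open>j\<close> of
  a diagonal factor gives the same product with \<open>off_mat i j 1 1\<close>; comparing the two
  images cancels the nonzero \<open>off_coeff i j\<close>.\<close>

lemma diag_coeff_eq: "diag_coeff i = diag_coeff j"
proof (cases "i = j")
  case False
  have "diag_coeff i c = diag_coeff j c" for c
  proof -
    have "off_mat i j (c / 2) (c / 2) = jordan_prod (diag_mat (\<lambda>a. if a = j then c else 0)) (off_mat i j 1 1)"
      using False by (auto simp: matrix_eq_iff jordan_diag_mat_nth off_mat_nth)
    then have "\<phi> (off_mat i j (c / 2) (c / 2)) $ i $ j = diag_coeff j c * off_coeff i j / 2"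
      using False by (simp add: diag_nth off_coeff_def diag_coeff_0)
    then show ?thesis using diag_coeff_half[OF False] off_coeff_nonzero[OF False] two_neq_0 by simp
  qed
  then show ?thesis by blast
qed simp

definition \<omega> :: "'a \<Rightarrow> 'a" where "\<omega> = diag_coeff undefined"

lemma diag_coeff_eq_\<omega>: "diag_coeff i = \<omega>"
  unfolding \<omega>_def by (rule diag_coeff_eq)

lemma scale: "\<phi> (mat_smult c X) = mat_smult (\<omega> c) (\<phi> X)"
proof -
  have "mat_smult c X = jordan_prod (diag_mat (\<lambda>a. c)) X"
    using two_neq_0 by (auto simp: matrix_eq_iff jordan_diag_mat_nth)
  then have "\<phi> (mat_smult c X) = \<phi> (jordan_prod (diag_mat (\<lambda>a. c)) X)" by (rule arg_cong)
  then show ?thesis using two_neq_0 by (simp only:) (simp add: matrix_eq_iff diag_nth diag_coeff_eq_\<omega>)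
qed

lemma \<omega>_0: "\<omega> 0 = 0" and \<omega>_1: "\<omega> 1 = 1" and \<omega>_mult: "\<omega> (x * y) = \<omega> x * \<omega> y"
  using diag_coeff_0 diag_coeff_1 diag_coeff_mult by (simp_all add: diag_coeff_eq_\<omega>)

text \<open>Additivity is not yet available at this point. Instead, \<open>off_mat j i 1 1\<close>
  is written as twice its half, and the image of the half is already known from
  \<open>diag_coeff_half\<close>.\<close>

lemma \<omega>_2: "\<omega> 2 = 2"
proof -
  obtain i j :: 'n where ij: "j \<noteq> i" using other_index[OF card_ge_2] by blast
  define h where "h = 1 / (2::'a)"
  have h: "2 * h = 1" using two_neq_0 unfolding h_def by simp
  have "off_mat j i 1 1 = mat_smult 2 (off_mat j i h h)"
    by (simp add: matrix_eq_iff off_mat_nth h)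
  then have "off_coeff j i = \<omega> 2 * \<phi> (off_mat j i h h) $ j $ i"
    unfolding off_coeff_def by (metis scale mat_smult_nth)
  also have "\<phi> (off_mat j i h h) $ j $ i = off_coeff j i / 2"
    unfolding h_def diag_coeff_half[OF ij] diag_coeff_1 by (rule arg_cong[OF mult_1])
  finally have "off_coeff j i = \<omega> 2 * (off_coeff j i / 2)" .
  then have "2 * off_coeff j i = 2 * (\<omega> 2 * (off_coeff j i / 2))" by (rule arg_cong)
  also have "\<dots> = \<omega> 2 * off_coeff j i" using two_neq_0 by simp
  finally show ?thesis using off_coeff_nonzero[OF ij] by simp
qed

lemma \<omega>_half: "\<omega> (x / 2) = \<omega> x / 2"
  using \<omega>_mult[of "x/2" 2] two_neq_0 by (simp add: \<omega>_2)

lemma \<omega>_4: "\<omega> 4 = 4"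
  using \<omega>_mult[of 2 2] by (simp add: \<omega>_2)

lemma off_image:
  assumes ij: "i \<noteq> j"
  shows "\<phi> (off_mat i j (X $ i $ j) (X $ j $ i)) = off_mat i j (\<phi> X $ i $ j) (\<phi> X $ j $ i)"
proof -
  have "off_mat i j (X $ i $ j) (X $ j $ i) = mat_smult 4 (off_mat i j (X $ i $ j / 4) (X $ j $ i / 4))"
    using four_neq_0 by (auto simp: matrix_eq_iff off_mat_nth)
  then show ?thesis
    using four_neq_0 by (simp add: scale off_image_quarter[OF ij] \<omega>_4) (auto simp: matrix_eq_iff off_mat_nth)
qed

lemma off_cong:
  assumes "i \<noteq> j" "X $ i $ j = Y $ i $ j" "X $ j $ i = Y $ j $ i"
  shows "\<phi> X $ i $ j = \<phi> Y $ i $ j"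
proof -
  have "off_mat i j (\<phi> X $ i $ j) (\<phi> X $ j $ i) = off_mat i j (\<phi> Y $ i $ j) (\<phi> Y $ j $ i)"
    using off_image[OF assms(1), of X] off_image[OF assms(1), of Y] assms by simp
  then have "off_mat i j (\<phi> X $ i $ j) (\<phi> X $ j $ i) $ i $ j = off_mat i j (\<phi> Y $ i $ j) (\<phi> Y $ j $ i) $ i $ j"
    by simp
  then show ?thesis by (simp add: off_mat_nth)
qed

lemma S_image:
  assumes ij: "i \<noteq> j"
  shows "\<phi> (off_mat i j 1 1) = off_mat i j (off_coeff i j) (off_coeff j i)"
  using off_shape[OF ij, of 1 1] off_commute[OF ij, of "1::'a" 1] by (simp add: off_coeff_def)

text \<open>The product of \<open>off_mat i j 1 1\<close> with \<open>X\<close> carries half the sum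
  of the two diagonal entries at both \<open>(i, j)\<close> and \<open>(j, i)\<close>. By
  \<open>off_cong\<close> it can be replaced there by a scalar multiple of
  \<open>off_mat i j 1 1\<close>.\<close>

lemma diag_sum:
  assumes ij: "i \<noteq> j"
  shows "\<phi> X $ i $ i + \<phi> X $ j $ j = \<omega> (X $ i $ i + X $ j $ j)"
proof -
  let ?S = "off_mat i j 1 1 :: 'a^'n^'n" and ?c = "(X $ i $ i + X $ j $ j) / 2"
  have "\<phi> (jordan_prod ?S X) $ i $ j = \<phi> (mat_smult ?c ?S) $ i $ j"
    using ij by (intro off_cong) (auto simp: jordan_off_mat_nth off_mat_nth)
  moreover have "\<phi> (jordan_prod ?S X) $ i $ j = off_coeff i j * (\<phi> X $ i $ i + \<phi> X $ j $ j) / 2"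
    using ij by (simp add: off S_image jordan_off_mat_nth algebra_simps)
  moreover have "\<phi> (mat_smult ?c ?S) $ i $ j = off_coeff i j * \<omega> (X $ i $ i + X $ j $ j) / 2"
    by (simp add: scale off_coeff_def \<omega>_half)
  ultimately show ?thesis using off_coeff_nonzero[OF ij] two_neq_0 by simp
qed

text \<open>Multiplying \<open>X\<close> by \<open>unit_mat i\<close> first makes the diagonal entry
  at \<open>j\<close> vanish, both in the argument and in the image, so \<open>diag_sum\<close>
  loses one summand.\<close>

lemma diag_entry: "\<phi> X $ i $ i = \<omega> (X $ i $ i)"
proof -
  obtain j where ij: "i \<noteq> j" using other_index[OF card_ge_2] by metis
  show ?thesis
    using diag_sum[OF ij, of "jordan_prod (unit_mat i) X"] ij two_neq_0
    by (simp add: unit_nth) (simp add: jordan_diag_mat_nth)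
qed

lemma \<omega>_add: "\<omega> (x + y) = \<omega> x + \<omega> y"
proof -
  obtain i j :: 'n where ij: "j \<noteq> i" using other_index[OF card_ge_2] by blast
  show ?thesis
    using diag_sum[OF ij, of "diag_mat (\<lambda>a. if a = j then x else y)"] ij
    by (simp add: diag_entry diag_mat_nth)
qed

lemma \<omega>_minus: "\<omega> (- x) = - \<omega> x"
  using \<omega>_add[of x "-x"] by (simp add: \<omega>_0 eq_neg_iff_add_eq_0 add.commute)

lemma \<omega>_mono: "ring_monomorphism \<omega>"
proof -
  have "x = y" if "\<omega> x = \<omega> y" for x y
  proof (rule ccontr)
    assume "x \<noteq> y"
    have "\<omega> (x - y) = 0" using \<omega>_add[of x "-y"] that by (simp add: \<omega>_minus)
    then have "\<omega> ((x - y) * inverse (x - y)) = 0" by (simp add: \<omega>_mult)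
    then show False using \<open>x \<noteq> y\<close> \<omega>_1 by simp
  qed
  then show ?thesis
    by (auto simp: ring_monomorphism_def \<omega>_add \<omega>_mult \<omega>_1 inj_def)
qed

section \<open>Direct or transposed action on each pair of opposite positions\<close>

definition entry :: "bool \<Rightarrow> 'a^'n^'n \<Rightarrow> 'n \<Rightarrow> 'n \<Rightarrow> 'a"
  where "entry b X i j = (if b then X $ i $ j else X $ j $ i)"

definition oriented :: "bool \<Rightarrow> 'n \<Rightarrow> 'n \<Rightarrow> bool"
  where "oriented b i j \<longleftrightarrow> (\<forall>X. \<phi> X $ i $ j = off_coeff i j * \<omega> (entry b X i j))"

text \<open>This compares twice the \<open>(i, i)\<close> entry of the image of
  \<open>jordan_prod (off_mat i j x y) X\<close>, computed once by \<open>diag_entry\<close> and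
  once by multiplicativity together with \<open>off_shape\<close>.\<close>

lemma off_pairing:
  assumes ij: "i \<noteq> j" and "x \<noteq> 0" "y \<noteq> 0"
  shows "\<phi> (off_mat i j x y) $ i $ j * \<phi> X $ j $ i + \<phi> (off_mat i j x y) $ j $ i * \<phi> X $ i $ j
    = \<omega> (x * X $ j $ i + y * X $ i $ j)"
proof -
  have "\<phi> (jordan_prod (off_mat i j x y) X) $ i $ i =
      jordan_prod (off_mat i j (\<phi> (off_mat i j x y) $ i $ j) (\<phi> (off_mat i j x y) $ j $ i)) (\<phi> X) $ i $ i"
    using off_shape[OF ij] off[OF assms] by simp
  then show ?thesis
    unfolding diag_entry jordan_off_mat_nth[OF ij]
    using ij two_neq_0 by (simp add: \<omega>_half algebra_simps)
qed

text \<open>Pairing with \<open>off_mat i j 1 1\<close> and with \<open>?D\<close> gives two linear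
  equations for the two image entries at \<open>(i, j)\<close> and \<open>(j, i)\<close>. The
  coefficients \<open>u\<close>, \<open>v\<close> of the second turn out to be determined up to a
  common sign, and the system can then be solved.\<close>

lemma oriented_exists:
  assumes ij: "i \<noteq> j"
  shows "\<exists>b. oriented b i j \<and> oriented b j i"
proof -
  let ?D = "off_mat i j 1 (-1) :: 'a^'n^'n"
  define u v where "u = \<phi> ?D $ i $ j" and "v = \<phi> ?D $ j $ i"
  have st: "off_coeff i j * off_coeff j i = 1" using off_coeff_inverse[OF ij] .
  have 1: "off_coeff i j * \<phi> X $ j $ i + off_coeff j i * \<phi> X $ i $ j = \<omega> (X $ j $ i) + \<omega> (X $ i $ j)" for X
    using off_pairing[OF ij, of 1 1 X] off_commute[OF ij, of "1::'a" 1]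
    by (simp add: off_coeff_def \<omega>_add)
  have 2: "u * \<phi> X $ j $ i + v * \<phi> X $ i $ j = \<omega> (X $ j $ i) - \<omega> (X $ i $ j)" for X
    using off_pairing[OF ij, of 1 "-1" X] ij \<omega>_add[of "X $ j $ i" "- X $ i $ j"]
    by (simp add: u_def v_def \<omega>_minus)
  \<comment> \<open>The matrix \<open>?D\<close> is orthogonal to \<open>off_mat i j 1 1\<close>
    under the pairing, and its pairing with itself is -2.\<close>
  have 3: "off_coeff i j * v + off_coeff j i * u = 0"
    using 1[of ?D] ij by (simp add: u_def v_def off_mat_nth \<omega>_minus)
  have 4: "u * v + v * u = - 2"
    using 2[of ?D] ij by (simp add: u_def v_def off_mat_nth \<omega>_minus \<omega>_1)
  have s0: "off_coeff i j \<noteq> 0" "off_coeff j i \<noteq> 0" using off_coeff_nonzero ij by auto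
  have v: "v = - (off_coeff j i * off_coeff j i * u)"
    using 3 st by algebra
  have "2 * ((off_coeff j i * u) * (off_coeff j i * u)) = 2 * 1" using 4 v by algebra
  then have "(off_coeff j i * u) * (off_coeff j i * u) = 1" using two_neq_0 by (metis mult_left_cancel)
  then have "off_coeff j i * u = 1 \<or> off_coeff j i * u = - 1" by (simp add: square_eq_1_iff)
  \<comment> \<open>The sign separates the cases: plus gives the direct action, minus the transposed
    one.\<close>
  then have "(u = off_coeff i j \<and> v = - off_coeff j i) \<or> (u = - off_coeff i j \<and> v = off_coeff j i)"
    using v st by algebra
  then show ?thesis
  proof
    assume uv: "u = off_coeff i j \<and> v = - off_coeff j i"
    have "2 * (off_coeff i j * \<phi> X $ j $ i) = 2 * \<omega> (X $ j $ i)"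
         "2 * (off_coeff j i * \<phi> X $ i $ j) = 2 * \<omega> (X $ i $ j)" for X
      using 1[of X] 2[of X] uv by algebra+
    then have e: "off_coeff i j * \<phi> X $ j $ i = \<omega> (X $ j $ i)" "off_coeff j i * \<phi> X $ i $ j = \<omega> (X $ i $ j)" for X
      using two_neq_0 by simp_all
    have "\<phi> X $ j $ i = off_coeff j i * \<omega> (X $ j $ i)" "\<phi> X $ i $ j = off_coeff i j * \<omega> (X $ i $ j)" for X
      using st e[of X] by algebra+
    then have "oriented True i j \<and> oriented True j i" by (simp add: oriented_def entry_def)
    then show ?thesis by blast
  next
    assume uv: "u = - off_coeff i j \<and> v = off_coeff j i"
    have "2 * (off_coeff i j * \<phi> X $ j $ i) = 2 * \<omega> (X $ i $ j)"
         "2 * (off_coeff j i * \<phi> X $ i $ j) = 2 * \<omega> (X $ j $ i)" for X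
      using 1[of X] 2[of X] uv by algebra+
    then have e: "off_coeff i j * \<phi> X $ j $ i = \<omega> (X $ i $ j)" "off_coeff j i * \<phi> X $ i $ j = \<omega> (X $ j $ i)" for X
      using two_neq_0 by simp_all
    have "\<phi> X $ j $ i = off_coeff j i * \<omega> (X $ i $ j)" "\<phi> X $ i $ j = off_coeff i j * \<omega> (X $ j $ i)" for X
      using st e[of X] by algebra+
    then have "oriented False i j \<and> oriented False j i" by (simp add: oriented_def entry_def)
    then show ?thesis by blast
  qed
qed

text \<open>An orientation of \<open>(i, j)\<close> is unique, since \<open>off_mat i j 1 0\<close>
  tells the two possibilities apart. Hence \<open>b\<close> is the orientation that
  \<open>oriented_exists\<close> provides for both positions.\<close>

lemma oriented_sym: "i \<noteq> j \<Longrightarrow> oriented b i j \<Longrightarrow> oriented b j i"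
proof -
  assume ij: "i \<noteq> j" and t: "oriented b i j"
  obtain b' where b': "oriented b' i j" "oriented b' j i" using oriented_exists[OF ij] by blast
  let ?X = "off_mat i j 1 0 :: 'a^'n^'n"
  have "off_coeff i j * \<omega> (entry b ?X i j) = off_coeff i j * \<omega> (entry b' ?X i j)"
    using t b' unfolding oriented_def by metis
  then have "b = b'" using off_coeff_nonzero[OF ij] ij
    by (auto simp: entry_def off_mat_nth \<omega>_0 \<omega>_1 split: if_splits)
  then show ?thesis using b' by simp
qed

text \<open>The Jordan product with \<open>off_mat i j 1 1\<close> moves position \<open>(j, l)\<close> to \<open>(i, l)\<close>.\<close>

lemma oriented_step:
  assumes "i \<noteq> j" "j \<noteq> l" "i \<noteq> l" and t: "oriented b j l"
  shows "oriented b i l" and "off_coeff i l = off_coeff i j * off_coeff j l"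
proof -
  obtain b' where b': "oriented b' i l" using oriented_exists[OF assms(3)] by blast
  have 1: "off_coeff i l * \<omega> (entry b' X j l) = off_coeff i j * (off_coeff j l * \<omega> (entry b X j l))" for X
  proof -
    let ?S = "off_mat i j 1 1 :: 'a^'n^'n"
    have "\<phi> (jordan_prod ?S X) $ i $ l = off_coeff i l * \<omega> (entry b' (jordan_prod ?S X) i l)"
      using b' by (simp add: oriented_def)
    moreover have "entry b' (jordan_prod ?S X) i l = entry b' X j l / 2"
      using assms by (simp add: entry_def jordan_off_mat_nth)
    moreover have "\<phi> (jordan_prod ?S X) $ i $ l = off_coeff i j * \<phi> X $ j $ l / 2"
      using assms by (simp add: off S_image jordan_off_mat_nth)
    ultimately show ?thesis using t two_neq_0 by (simp add: oriented_def \<omega>_half)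
  qed
  have e: "entry b (off_mat j l 1 0) j l = (if b then 1 else 0)" for b
    using assms by (simp add: entry_def off_mat_nth)
  have e': "entry b (off_mat j l 1 1) j l = 1" for b
    using assms by (simp add: entry_def off_mat_nth)
  \<comment> \<open>The test matrix \<open>off_mat j l 1 0\<close> detects the orientation; the
    symmetric \<open>off_mat j l 1 1\<close> then yields the cocycle identity.\<close>
  have "b = b'" using 1[of "off_mat j l 1 0"] off_coeff_nonzero assms
    by (auto simp: e \<omega>_0 \<omega>_1 split: if_splits)
  then show "oriented b i l" using b' by simp
  show "off_coeff i l = off_coeff i j * off_coeff j l" using 1[of "off_mat j l 1 1"] by (simp add: e' \<omega>_1)
qed

text \<open>All pairs are linked through \<open>i0\<close>: the orientation passes from
  \<open>(j0, i0)\<close> to \<open>(l, i0)\<close>, by symmetry to \<open>(i0, l)\<close>, and from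
  there to \<open>(m, l)\<close>.\<close>

lemma oriented_uniform: "\<exists>b. \<forall>i j. i \<noteq> j \<longrightarrow> oriented b i j"
proof -
  obtain i0 j0 :: 'n where ij: "j0 \<noteq> i0" using other_index[OF card_ge_2] by blast
  obtain b where b: "oriented b i0 j0" "oriented b j0 i0" using oriented_exists ij by metis
  have 1: "oriented b l i0" if "l \<noteq> i0" for l
    using oriented_step(1)[of l j0 i0 b] that b ij by (cases "l = j0") auto
  then have 2: "oriented b i0 l" if "l \<noteq> i0" for l
    using that oriented_sym by metis
  have "oriented b m l" if "m \<noteq> l" for m l
    using oriented_step(1)[of m i0 l b] that 1 2 by (cases "l = i0"; cases "m = i0") auto
  then show ?thesis by blast
qed

text \<open>The cocycle \<open>off_coeff\<close> is a coboundary: with an arbitrary base index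
  \<open>o0\<close>, the product rule through \<open>o0\<close> and the inverse rule give
  \<open>off_coeff i j = t i / t j\<close>.\<close>

lemma entrywise_form:
  "\<exists>b t. (\<forall>i. t i \<noteq> 0) \<and> (\<forall>X i j. \<phi> X $ i $ j = t i * \<omega> (entry b X i j) / t j)"
proof -
  obtain b where b: "\<And>i j. i \<noteq> j \<Longrightarrow> oriented b i j" using oriented_uniform by blast
  define o0 where "o0 = (undefined :: 'n)"
  define t where "t i = (if i = o0 then 1 else off_coeff i o0)" for i
  have t0: "t i \<noteq> 0" for i by (simp add: t_def off_coeff_nonzero)
  have "off_coeff i j = t i / t j" if "i \<noteq> j" for i j
  proof -
    have inv: "off_coeff o0 j = 1 / off_coeff j o0" if "j \<noteq> o0"
      using off_coeff_inverse[of o0 j] off_coeff_nonzero[of j o0] that by (simp add: field_simps)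
    show ?thesis
      using that oriented_step(2)[of i o0 j b] b[of o0 j] inv
      by (cases "i = o0"; cases "j = o0") (auto simp: t_def)
  qed
  then have "\<phi> X $ i $ j = t i * \<omega> (entry b X i j) / t j" for X i j
    using b[of i j] diag_entry[of X i] t0[of i] by (cases "i = j") (auto simp: oriented_def entry_def)
  with t0 show ?thesis by blast
qed

end

section \<open>Reduction to the unital case\<close>

locale jordan_power_map =
  fixes \<phi> :: "'a::alg_closed_field^'n^'n \<Rightarrow> 'a^'n^'n" and k :: nat
  assumes two_neq_0: "(2::'a) \<noteq> 0"
    and card_ge_2: "2 \<le> CARD('n)"
    and k_pos: "0 < k"
    and jordan: "\<And>A B. \<phi> (jordan_prod (mat_pow A k) B) = jordan_prod (mat_pow (\<phi> A) k) (\<phi> B)"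
begin

section \<open>Matrices with the same image as zero\<close>

definition zero_fibre :: "('a^'n^'n) set" where "zero_fibre = {X. \<phi> X = \<phi> 0}"

text \<open>Replacing \<open>X\<close> by 0 leaves the right-hand side of the functional equation
  unchanged, while the product on the left becomes 0 because \<open>k\<close> is positive.\<close>

lemma zero_fibre_left: "X \<in> zero_fibre \<Longrightarrow> jordan_prod (mat_pow X k) B \<in> zero_fibre"
  using jordan[of X B] jordan[of 0 B] k_pos by (simp add: zero_fibre_def mat_pow_mat_0)

lemma zero_fibre_right:
  assumes "X \<in> zero_fibre" shows "jordan_prod (mat_pow A k) X \<in> zero_fibre"
  using jordan[of A X] jordan[of A 0] assms by (simp add: zero_fibre_def)

definition coord_proj :: "'n set \<Rightarrow> 'a^'n^'n" where "coord_proj S = diag_mat (\<lambda>a. if a \<in> S then 1 else 0)"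

lemma coord_proj_pow: "mat_pow (coord_proj S) k = coord_proj S"
  using k_pos by (auto simp: coord_proj_def mat_pow_diag_mat matrix_eq_iff diag_mat_nth zero_power)

text \<open>One absorbed product leads from the projection to \<open>C\<close>, in which the index
  \<open>i\<close> is replaced by the swap of \<open>i\<close> and \<open>j\<close>. Since
  \<open>C\<close> cubed is \<open>C\<close>, it has a k-th root, so its square, the larger
  projection, is absorbed too.\<close>

lemma coord_proj_insert:
  assumes "coord_proj S \<in> zero_fibre" "i \<in> S" "j \<notin> S"
  shows "coord_proj (insert j S) \<in> zero_fibre"
proof -
  have ij: "i \<noteq> j" using assms by blast
  define C where "C = coord_proj (S - {i}) + off_mat i j 1 1"
  \<comment> \<open>The entries 2 offset the halving at positions with one index inside
    \<open>S\<close> and one outside.\<close>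
  define B where "B = coord_proj (S - {i}) + off_mat i j 2 2"
  have "jordan_prod (coord_proj S) B $ a $ b = C $ a $ b" for a b
    unfolding coord_proj_def jordan_diag_mat_nth unfolding B_def C_def coord_proj_def vector_add_component diag_mat_nth off_mat_nth
    using assms two_neq_0
    by (cases "a \<in> S"; cases "b \<in> S"; cases "a = b"; cases "a = i"; cases "a = j"; cases "b = i"; cases "b = j"; simp)
  then have "jordan_prod (coord_proj S) B = C" by (simp add: matrix_eq_iff)
  then have CJ: "C \<in> zero_fibre" using zero_fibre_left[OF assms(1), of B] by (simp add: coord_proj_pow)
  have "(C ** C) $ a $ b = coord_proj (insert j S) $ a $ b" for a b
    unfolding C_def coord_proj_def matrix_add_ldistrib matrix_mult_add_rdistrib vector_add_component
      diag_mat_mult_nth mult_diag_mat_nth off_mat_mult_nth[OF ij] mult_off_mat_nth[OF ij]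
      diag_mat_nth off_mat_nth
    using assms ij
    by (cases "a \<in> S"; cases "b \<in> S"; cases "a = b"; cases "a = i"; cases "a = j"; cases "b = i"; cases "b = j"; simp)
  then have CC: "C ** C = coord_proj (insert j S)" by (simp add: matrix_eq_iff)
  have "C ** C ** C = mat_smult (1 * 1) C"
    unfolding CC matrix_eq_iff
    unfolding C_def coord_proj_def matrix_add_ldistrib mat_smult_nth vector_add_component
      diag_mat_mult_nth diag_mat_nth off_mat_nth
    using assms ij by auto
  then obtain R where "mat_pow R k = C"
    using mat_root_exists[OF two_neq_0 _ _ k_pos, of 1 C] by auto
  then show ?thesis using zero_fibre_right[OF CJ, of R] CC two_neq_0 by (simp add: jordan_prod_self)
qed

text \<open>Adding the indices one at a time reaches the identity, whose Jordan multiples are all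
  matrices.\<close>

lemma constant_if_unit_mat_in_zero_fibre:
  assumes "unit_mat i \<in> zero_fibre"
  shows "X \<in> zero_fibre"
proof -
  have "coord_proj (insert i S) \<in> zero_fibre" if "finite S" for S
    using that
  proof (induction S)
    case empty
    then show ?case using assms by (simp add: coord_proj_def)
  next
    case (insert j S)
    then show ?case using coord_proj_insert[of "insert i S" i j]
      by (cases "j = i") (auto simp: insert_commute)
  qed
  from this[of UNIV] have "coord_proj UNIV \<in> zero_fibre" by simp
  moreover have "coord_proj UNIV = mat 1" by (simp add: coord_proj_def matrix_eq_iff diag_mat_nth mat_def)
  ultimately show ?thesis
    using zero_fibre_left[of "mat 1" X] coord_proj_pow[of UNIV] two_neq_0 by (simp add: jordan_prod_mat_1)
qed

section \<open>Images of idempotents and the frame\<close>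

lemma idempotent_image:
  assumes "q ** q = q"
  shows "mat_pow (\<phi> q) k ** \<phi> q = \<phi> q" "\<phi> q ** mat_pow (\<phi> q) k = \<phi> q"
    "mat_pow (\<phi> q) k ** mat_pow (\<phi> q) k = mat_pow (\<phi> q) k"
proof -
  have comm: "mat_pow (\<phi> q) k ** \<phi> q = \<phi> q ** mat_pow (\<phi> q) k"
    by (simp add: mat_pow_commute_matrix)
  \<comment> \<open>An idempotent satisfies \<open>jordan_prod (mat_pow q k) q = q\<close>. So the
    k-th power of its image fixes that image, and therefore every positive power of it.\<close>
  have "\<phi> q = jordan_prod (mat_pow (\<phi> q) k) (\<phi> q)"
    using jordan[of q q] assms two_neq_0 by (simp add: mat_pow_idempotent k_pos jordan_prod_self)
  also have "\<dots> = mat_pow (\<phi> q) k ** \<phi> q"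
    using two_neq_0 by (simp add: matrix_eq_iff jordan_prod_nth flip: comm)
  finally show 1: "mat_pow (\<phi> q) k ** \<phi> q = \<phi> q" by simp
  with comm show "\<phi> q ** mat_pow (\<phi> q) k = \<phi> q" by simp
  have "mat_pow (\<phi> q) k ** mat_pow (\<phi> q) m = mat_pow (\<phi> q) m" if "0 < m" for m
    using that 1 by (cases m) (simp_all add: matrix_mul_assoc)
  then show "mat_pow (\<phi> q) k ** mat_pow (\<phi> q) k = mat_pow (\<phi> q) k"
    using k_pos by blast
qed

lemma unit_mat_idempotent: "unit_mat i ** unit_mat i = (unit_mat i :: 'a^'n^'n)"
  by (auto simp: matrix_eq_iff diag_mat_mult_nth diag_mat_nth)

text \<open>The value at 0 is not yet known to vanish, so its k-th power \<open>F\<close> is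
  subtracted from each \<theta>. The differences are nonzero orthogonal idempotents; being as many
  as the dimension, they leave no room for \<open>F\<close>.\<close>

lemma nonconstant_frame:
  assumes "X \<notin> zero_fibre"
  obtains T T' where "T ** T' = mat 1" "T' ** T = mat 1"
    "\<And>i. T' ** mat_pow (\<phi> (unit_mat i)) k ** T = unit_mat i"
proof -
  define Z where "Z = \<phi> 0"
  define F where "F = mat_pow Z k"
  have F: "F ** F = F" "F ** Z = Z" "Z ** F = Z"
    using idempotent_image[of 0] by (simp_all add: F_def Z_def)
  \<comment> \<open>The Jordan product of 0 with \<open>A\<close> is 0, so \<open>F\<close> and the
    image of \<open>A\<close> have Jordan product \<open>Z\<close>, and \<open>peirce\<close> splits
    it.\<close>
  have FZ: "F ** \<phi> A = Z" "\<phi> A ** F = Z" for A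
    using peirce[OF two_neq_0 F, of "\<phi> A"] jordan[of 0 A] k_pos
    by (simp_all add: F_def Z_def mat_pow_mat_0)
  define \<theta> where "\<theta> i = mat_pow (\<phi> (unit_mat i)) k" for i
  note \<theta> = idempotent_image[OF unit_mat_idempotent, folded \<theta>_def]
  have F\<theta>: "F ** \<theta> i = F" "\<theta> i ** F = F" for i
  proof -
    \<comment> \<open>Behind \<open>F\<close>, each factor \<open>\<phi> (unit_mat i)\<close> may be
      exchanged for \<open>Z\<close>.\<close>
    have "F ** mat_pow (\<phi> (unit_mat i)) m = F ** mat_pow Z m" for m
    proof (induction m)
      case (Suc m)
      have "F ** mat_pow (\<phi> (unit_mat i)) (Suc m) = (F ** \<phi> (unit_mat i)) ** mat_pow (\<phi> (unit_mat i)) m"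
        by (simp add: matrix_mul_assoc)
      also have "\<dots> = Z ** (F ** mat_pow (\<phi> (unit_mat i)) m)"
        by (simp add: FZ F matrix_mul_assoc)
      also have "\<dots> = F ** mat_pow Z (Suc m)"
        using F by (simp add: Suc matrix_mul_assoc)
      finally show ?case .
    qed simp
    then show 1: "F ** \<theta> i = F" using F by (simp add: \<theta>_def F_def)
    have "F ** \<phi> (unit_mat i) = \<phi> (unit_mat i) ** F" by (simp add: FZ)
    then show "\<theta> i ** F = F" using 1 by (metis \<theta>_def mat_pow_commute_matrix)
  qed
  define R where "R i = \<theta> i - F" for i
  have idem: "R i ** R i = R i" for i
    by (simp add: R_def matrix_mult_diff_ldistrib matrix_mult_diff_rdistrib \<theta> F\<theta> F)
  have nz: "R i \<noteq> 0" for i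
  proof
    assume "R i = 0"
    then have "\<phi> (unit_mat i) = Z" using \<theta>(1)[of i] FZ(1)[of "unit_mat i"] by (simp add: R_def)
    then have "unit_mat i \<in> zero_fibre" by (simp add: zero_fibre_def Z_def)
    then show False using constant_if_unit_mat_in_zero_fibre assms by blast
  qed
  have orth: "R i ** R j = 0" if "i \<noteq> j" for i j
  proof -
    have "jordan_prod (unit_mat i) (unit_mat j) = (0::'a^'n^'n)"
      using that by (auto simp: matrix_eq_iff jordan_diag_mat_nth diag_mat_nth)
    then have "jordan_prod (\<theta> i) (\<phi> (unit_mat j)) = Z"
      using jordan[of "unit_mat i" "unit_mat j"]
      by (simp add: \<theta>_def Z_def mat_pow_idempotent k_pos unit_mat_idempotent)
    \<comment> \<open>Both \<theta> and \<open>F\<close> have Jordan product \<open>Z\<close> with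
      this image, so the difference gives 0.\<close>
    then have "jordan_prod (R i) (\<phi> (unit_mat j)) = 0"
      by (simp add: R_def jordan_prod_def matrix_mult_diff_ldistrib matrix_mult_diff_rdistrib FZ)
        (simp add: matrix_eq_iff, use two_neq_0 in \<open>simp add: field_simps\<close>)
    then have "R i ** \<phi> (unit_mat j) = 0"
      using peirce(1)[OF two_neq_0 idem[of i], of 0 "\<phi> (unit_mat j)"] by simp
    then have "R i ** \<theta> j = 0"
      using k_pos by (cases k) (simp_all add: \<theta>_def matrix_mul_assoc)
    moreover have "R i ** F = 0"
      by (simp add: R_def matrix_mult_diff_rdistrib F\<theta> F)
    ultimately show ?thesis by (simp add: R_def[of j] matrix_mult_diff_ldistrib)
  qed
  obtain T T' where T: "T ** T' = mat 1" "T' ** T = mat 1" and RT: "\<And>i. R i ** T = T ** unit_mat i"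
    using orthogonal_idempotents_diagonalize[of R, OF idem nz orth] by blast
  have "F ** T = 0"
  proof -
    \<comment> \<open>By \<open>RT\<close>, column \<open>b\<close> of \<open>T\<close> lies in the
      range of \<open>R b\<close>, which \<open>F\<close> annihilates.\<close>
    have "F ** T ** unit_mat b = 0" for b
    proof -
      have "F ** T ** unit_mat b = F ** R b ** T" by (simp add: RT flip: matrix_mul_assoc)
      also have "F ** R b = 0" by (simp add: R_def matrix_mult_diff_ldistrib F\<theta> F)
      finally show ?thesis by simp
    qed
    then have "(F ** T ** unit_mat b) $ a $ b = 0" for a b by simp
    then show ?thesis by (simp add: mult_diag_mat_nth matrix_eq_iff)
  qed
  then have "F ** (T ** T') = 0" by (simp add: matrix_mul_assoc)
  then have "F = 0" by (simp add: T)
  then have "T' ** \<theta> i ** T = unit_mat i" for i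
    using RT[of i] T by (simp add: R_def flip: matrix_mul_assoc) (simp add: T matrix_mul_assoc)
  with T that show ?thesis unfolding \<theta>_def by blast
qed

end

section \<open>The image of the identity is a scalar matrix\<close>

locale framed_jordan_power_map = jordan_power_map \<phi> k
  for \<phi> :: "'a::alg_closed_field^'n^'n \<Rightarrow> 'a^'n^'n" and k +
  assumes frame: "\<And>i. mat_pow (\<phi> (unit_mat i)) k = unit_mat i"
begin

lemma unit_jordan: "\<phi> (jordan_prod (unit_mat i) X) = jordan_prod (unit_mat i) (\<phi> X)"
  using jordan[of "unit_mat i" X] by (simp add: frame mat_pow_idempotent k_pos unit_mat_idempotent)

text \<open>Apply the functional equation to \<open>q\<close> and the identity, then
  \<open>peirce\<close> with \<open>Z\<close> the image of \<open>q\<close>. In particular the image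
  of the identity commutes with \<open>mat_pow (\<phi> q) k\<close>.\<close>

lemma idempotent_image_one:
  assumes "q ** q = q"
  shows "mat_pow (\<phi> q) k ** \<phi> (mat 1) = \<phi> q" "\<phi> (mat 1) ** mat_pow (\<phi> q) k = \<phi> q"
proof -
  have "jordan_prod (mat_pow (\<phi> q) k) (\<phi> (mat 1)) = \<phi> q"
    using jordan[of q "mat 1"] assms by (simp add: mat_pow_idempotent k_pos jordan_prod_mat_1 two_neq_0)
  then show "mat_pow (\<phi> q) k ** \<phi> (mat 1) = \<phi> q" "\<phi> (mat 1) ** mat_pow (\<phi> q) k = \<phi> q"
    using peirce[OF two_neq_0 idempotent_image(3)[OF assms] idempotent_image(1,2)[OF assms]] by blast+
qed

definition one_coeff :: "'n \<Rightarrow> 'a" where "one_coeff i = \<phi> (mat 1) $ i $ i"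

lemma image_one: "\<phi> (mat 1) = diag_mat one_coeff"
proof -
  have "\<phi> (mat 1) $ a $ b = 0" if "a \<noteq> b" for a b
  proof -
    have "unit_mat a ** \<phi> (mat 1) = \<phi> (mat 1) ** unit_mat a"
      using idempotent_image_one[OF unit_mat_idempotent, of a] by (simp add: frame)
    then have "(unit_mat a ** \<phi> (mat 1)) $ a $ b = (\<phi> (mat 1) ** unit_mat a) $ a $ b" by simp
    then show ?thesis using that by (simp add: mult_diag_mat_nth diag_mat_mult_nth)
  qed
  then show ?thesis by (simp add: matrix_eq_iff diag_mat_nth one_coeff_def)
qed

lemma image_unit: "\<phi> (unit_mat i) = mat_smult (one_coeff i) (unit_mat i)"
proof -
  have "\<phi> (unit_mat i) = unit_mat i ** diag_mat one_coeff"
    using idempotent_image_one(1)[OF unit_mat_idempotent, of i] by (simp add: frame image_one)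
  then show ?thesis by (simp only:) (auto simp: matrix_eq_iff diag_mat_mult_nth diag_mat_nth)
qed

lemma image_0: "\<phi> 0 = 0"
proof -
  obtain i j :: 'n where ij: "j \<noteq> i" using other_index[OF card_ge_2] by blast
  have 0: "jordan_prod (unit_mat i) (unit_mat j) = (0::'a^'n^'n)"
    using ij by (auto simp: matrix_eq_iff jordan_diag_mat_nth diag_mat_nth)
  then show ?thesis using unit_jordan[of i "unit_mat j"] by (simp add: image_unit jordan_prod_mat_smult)
qed

lemma unit_mat_notin_zero_fibre: "unit_mat i \<notin> zero_fibre"
proof
  assume "unit_mat i \<in> zero_fibre"
  then have "unit_mat i = (0 :: 'a^'n^'n)"
    using frame[of i] k_pos by (simp add: zero_fibre_def image_0 mat_pow_mat_0)
  then have "unit_mat i $ i $ i = (0::'a)" by simp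
  then show False by (simp add: diag_mat_nth)
qed

text \<open>The image of the idempotent \<open>(coord_proj {i, j} + off_mat i j 1 1) / 2\<close> has nonzero entries off the
  diagonal, but its power commutes with \<open>\<phi> (mat 1)\<close>.\<close>

lemma one_coeff_eq: "one_coeff i = one_coeff j"
proof (rule ccontr)
  assume ne: "one_coeff i \<noteq> one_coeff j"
  then have ij: "i \<noteq> j" by auto
  define h where "h = 1 / (2::'a)"
  have h: "h + h = 1" using two_neq_0 by (simp add: h_def)
  define q where "q = mat_smult h (coord_proj {i, j} + off_mat i j 1 1)"
  have hh: "h * h + h * h = h" using h by algebra
  have "q ** q = q"
    using ij hh by (auto simp: q_def coord_proj_def mat_smult_mult mult_mat_smult matrix_add_ldistrib matrix_mult_add_rdistrib
       diag_mat_mult_nth mult_diag_mat_nth off_mat_mult_nth mult_off_mat_nth diag_mat_nth off_mat_nth matrix_eq_iff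
       distrib_left)
  note q = idempotent_image_one[OF this]
  define \<theta> where "\<theta> = mat_pow (\<phi> q) k"
  have "\<theta> ** diag_mat one_coeff = diag_mat one_coeff ** \<theta>" "\<theta> ** diag_mat one_coeff = \<phi> q"
    using q by (simp_all add: \<theta>_def image_one)
  then have \<theta>: "\<theta> $ a $ b * one_coeff b = one_coeff a * \<theta> $ a $ b" "\<theta> $ a $ b * one_coeff b = \<phi> q $ a $ b" for a b
    by (metis mult_diag_mat_nth diag_mat_mult_nth)+
  \<comment> \<open>A matrix commuting with a diagonal one vanishes wherever the two diagonal
    coefficients differ.\<close>
  have off0: "\<phi> q $ i $ j = 0" "\<phi> q $ j $ i = 0"
    using \<theta>[of i j] \<theta>[of j i] ne by (auto simp: mult.commute)
  \<comment> \<open>\<open>Y\<close> retains only the two off-diagonal entries of \<open>q\<close>,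
    each equal to \<open>h / 4\<close>, that is 1/8; the scalar 8 in \<open>D\<close> below restores
    them to 1.\<close>
  define Y where "Y = jordan_prod (unit_mat i) (jordan_prod (unit_mat j) q)"
  have "\<phi> Y = 0"
    unfolding Y_def unit_jordan using ij off0
    by (auto simp: matrix_eq_iff jordan_diag_mat_nth)
  then have YJ: "Y \<in> zero_fibre" by (simp add: zero_fibre_def image_0)
  define D :: "'a^'n^'n" where "D = diag_mat (\<lambda>a. 8)"
  have "jordan_prod D Y = off_mat i j 1 1"
  proof -
    have "(16::'a) = 2 * 2 * 2 * 2" by simp
    then have "(16::'a) \<noteq> 0" using two_neq_0 by (metis mult_eq_0_iff)
    then have "(8 + 8) * (h / 2 / 2) / 2 = 1" using two_neq_0 h by (simp add: h_def)
    then show ?thesis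
      using ij by (auto simp: matrix_eq_iff Y_def D_def q_def coord_proj_def jordan_diag_mat_nth off_mat_nth diag_mat_nth)
  qed
  moreover obtain R where "mat_pow R k = D"
    using diag_mat_root_exists[OF k_pos] D_def by metis
  ultimately have SJ: "off_mat i j 1 1 \<in> zero_fibre" using zero_fibre_right[OF YJ, of R] by simp
  obtain R' :: "'a^'n^'n" where "mat_pow R' k = off_mat i j 1 1"
    using off_mat_root_exists[OF two_neq_0 ij one_neq_zero one_neq_zero k_pos] by blast
  then have "jordan_prod (off_mat i j 1 1) (off_mat i j 1 1) \<in> zero_fibre"
    using zero_fibre_right[OF SJ, of R'] by simp
  \<comment> \<open>The square of \<open>off_mat i j 1 1\<close> is the projection onto the
    coordinates \<open>i\<close> and \<open>j\<close>; one more product leaves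
    \<open>unit_mat i\<close>.\<close>
  then have "jordan_prod (mat_pow (unit_mat i) k) (jordan_prod (off_mat i j 1 1) (off_mat i j 1 1)) \<in> zero_fibre"
    by (rule zero_fibre_right)
  moreover have "jordan_prod (mat_pow (unit_mat i) k) (jordan_prod (off_mat i j 1 1) (off_mat i j 1 1)) = (unit_mat i :: 'a^'n^'n)"
    using ij two_neq_0
    by (auto simp: mat_pow_idempotent k_pos unit_mat_idempotent matrix_eq_iff jordan_prod_self off_mat_mult_nth
       jordan_diag_mat_nth diag_mat_nth off_mat_nth)
  ultimately show False using unit_mat_notin_zero_fibre by simp
qed

definition \<epsilon> :: 'a where "\<epsilon> = one_coeff undefined"

lemma one_coeff_eq_\<epsilon>: "one_coeff i = \<epsilon>"
  unfolding \<epsilon>_def by (rule one_coeff_eq)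

lemma \<epsilon>_pow: "\<epsilon> ^ k = 1"
proof -
  have "mat_pow (\<phi> (unit_mat undefined)) k $ undefined $ undefined = (1::'a)"
    unfolding frame by (simp add: diag_mat_nth)
  then show ?thesis
    by (simp add: image_unit one_coeff_eq_\<epsilon> mat_pow_mat_smult mat_pow_idempotent k_pos unit_mat_idempotent diag_mat_nth)
qed

lemma \<epsilon>_nonzero: "\<epsilon> \<noteq> 0"
  using \<epsilon>_pow k_pos by (auto simp: zero_power)

definition \<psi> :: "'a^'n^'n \<Rightarrow> 'a^'n^'n" where "\<psi> X = mat_smult (inverse \<epsilon>) (\<phi> X)"

lemma \<phi>_eq: "\<phi> X = mat_smult \<epsilon> (\<psi> X)"
  using \<epsilon>_nonzero by (simp add: \<psi>_def mat_smult_smult)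

text \<open>Pairing \<open>R\<close> with the identity, whose image is \<epsilon> times the
  identity, gives \<open>\<psi> D = mat_pow (\<phi> R) k\<close>. The power in the functional
  equation can thus be read as an image under \<psi>.\<close>

lemma \<psi>_jordan:
  assumes "mat_pow R k = D"
  shows "\<psi> (jordan_prod D B) = jordan_prod (\<psi> D) (\<psi> B)"
proof -
  have one: "\<phi> (mat 1) = mat_smult \<epsilon> (mat 1)"
    unfolding image_one one_coeff_eq_\<epsilon> by (simp add: matrix_eq_iff diag_mat_nth mat_def)
  have "\<phi> D = mat_smult \<epsilon> (mat_pow (\<phi> R) k)"
    using jordan[of R "mat 1"] assms two_neq_0 by (simp add: one jordan_prod_mat_smult jordan_prod_mat_1)
  then have "\<psi> D = mat_pow (\<phi> R) k"
    using \<epsilon>_nonzero by (simp add: \<psi>_def mat_smult_smult)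
  then show ?thesis using jordan[of R B] assms by (simp add: \<psi>_def jordan_prod_mat_smult)
qed

sublocale unital: unital_jordan_map \<psi>
proof
  show "(2::'a) \<noteq> 0" "2 \<le> CARD('n)" by (rule two_neq_0 card_ge_2)+
  show "\<psi> (unit_mat i) = unit_mat i" for i
    using \<epsilon>_nonzero by (simp add: \<psi>_def image_unit one_coeff_eq_\<epsilon> mat_smult_smult)
  show "\<psi> (jordan_prod (diag_mat d) X) = jordan_prod (\<psi> (diag_mat d)) (\<psi> X)" for d X
    using diag_mat_root_exists[OF k_pos] \<psi>_jordan by metis
  show "\<psi> (jordan_prod (off_mat i j x y) X) = jordan_prod (\<psi> (off_mat i j x y)) (\<psi> X)"
    if "i \<noteq> j" "x \<noteq> 0" "y \<noteq> 0" for i j x y X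
    using off_mat_root_exists[OF two_neq_0 that k_pos] \<psi>_jordan by metis
qed

end

section \<open>Assembling the standard form\<close>

lemma matrix_inv_eqI:
  fixes A :: "'a::field^'n^'n"
  assumes "A ** B = mat 1"
  shows "matrix_inv A = B"
proof -
  have BA: "B ** A = mat 1" using assms by (simp only: matrix_left_right_inverse)
  with assms have "\<exists>A'. A ** A' = mat 1 \<and> A' ** A = mat 1" by blast
  then have "matrix_inv A ** A = mat 1" unfolding matrix_inv_def by (metis (mono_tags, lifting) someI_ex)
  then have "matrix_inv A ** (A ** B) = B" by (simp add: matrix_mul_assoc)
  then show ?thesis by (simp add: assms)
qed

text \<open>The quotients \<open>t i / t j\<close> amount to conjugation by
  \<open>diag_mat t\<close>, and the uniform orientation \<open>b\<close> selects the
  alternative.\<close>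

lemma (in framed_jordan_power_map) standard_form:
  obtains t \<omega> where "\<And>i. t i \<noteq> 0" "ring_monomorphism \<omega>"
    "(\<forall>X. \<phi> X = mat_smult \<epsilon> (diag_mat t ** map_matrix \<omega> X ** diag_mat (\<lambda>i. inverse (t i)))) \<or>
     (\<forall>X. \<phi> X = mat_smult \<epsilon> (diag_mat t ** transpose (map_matrix \<omega> X) ** diag_mat (\<lambda>i. inverse (t i))))"
proof -
  obtain b t where t: "\<And>i. t i \<noteq> 0" and
    form: "\<And>X i j. \<psi> X $ i $ j = t i * unital.\<omega> (unital.entry b X i j) / t j"
    using unital.entrywise_form by blast
  have "(\<forall>X. \<phi> X = mat_smult \<epsilon> (diag_mat t ** map_matrix unital.\<omega> X ** diag_mat (\<lambda>i. inverse (t i))))" if b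
    using that by (simp add: \<phi>_eq matrix_eq_iff form unital.entry_def mult_diag_mat_nth diag_mat_mult_nth divide_inverse)
  moreover have "(\<forall>X. \<phi> X = mat_smult \<epsilon> (diag_mat t ** transpose (map_matrix unital.\<omega> X) ** diag_mat (\<lambda>i. inverse (t i))))" if "\<not> b"
    using that by (simp add: \<phi>_eq matrix_eq_iff form unital.entry_def mult_diag_mat_nth diag_mat_mult_nth divide_inverse transpose_def)
  ultimately show ?thesis using that[of t unital.\<omega>] t unital.\<omega>_mono by blast
qed

text \<open>Conjugation by the frame matrix preserves the functional equation and gives a framed
  map; its diagonal similarity is then merged with the first one into \<open>U\<close>.\<close>

lemma (in jordan_power_map) nonconstant_form:
  assumes "X0 \<notin> zero_fibre"
  obtains T \<omega> \<epsilon> where "invertible (T :: 'a^'n^'n)" "ring_monomorphism \<omega>" "\<epsilon> ^ k = 1"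
    "(\<forall>X. \<phi> X = mat_smult \<epsilon> (T ** map_matrix \<omega> X ** matrix_inv T)) \<or>
     (\<forall>X. \<phi> X = mat_smult \<epsilon> (T ** transpose (map_matrix \<omega> X) ** matrix_inv T))"
proof -
  obtain T T' where T: "T ** T' = mat 1" "T' ** T = mat 1"
    and frame: "\<And>i. T' ** mat_pow (\<phi> (unit_mat i)) k ** T = unit_mat i"
    using nonconstant_frame[OF assms] by blast
  define \<phi>1 where "\<phi>1 X = T' ** \<phi> X ** T" for X
  have pow: "mat_pow (\<phi>1 X) k = T' ** mat_pow (\<phi> X) k ** T" for X
    unfolding \<phi>1_def by (rule mat_pow_similar[OF T])
  interpret f: framed_jordan_power_map \<phi>1 k
  proof
    show "(2::'a) \<noteq> 0" "2 \<le> CARD('n)" "0 < k" by (rule two_neq_0 card_ge_2 k_pos)+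
    show "\<phi>1 (jordan_prod (mat_pow A k) B) = jordan_prod (mat_pow (\<phi>1 A) k) (\<phi>1 B)" for A B
      unfolding pow unfolding \<phi>1_def jordan_prod_similar[OF T(1)] jordan ..
    show "mat_pow (\<phi>1 (unit_mat i)) k = unit_mat i" for i
      unfolding pow by (rule frame)
  qed
  obtain t \<omega> where t: "\<And>i. t i \<noteq> 0" and \<omega>: "ring_monomorphism \<omega>" and
    form: "(\<forall>X. \<phi>1 X = mat_smult f.\<epsilon> (diag_mat t ** map_matrix \<omega> X ** diag_mat (\<lambda>i. inverse (t i)))) \<or>
     (\<forall>X. \<phi>1 X = mat_smult f.\<epsilon> (diag_mat t ** transpose (map_matrix \<omega> X) ** diag_mat (\<lambda>i. inverse (t i))))"
    using f.standard_form by blast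
  define U where "U = T ** diag_mat t"
  define U' where "U' = diag_mat (\<lambda>i. inverse (t i)) ** T'"
  have "diag_mat t ** diag_mat (\<lambda>i. inverse (t i)) = (mat 1 :: 'a^'n^'n)"
    using t by (simp add: matrix_eq_iff diag_mat_mult_nth diag_mat_nth mat_def)
  then have "T ** (diag_mat t ** diag_mat (\<lambda>i. inverse (t i))) ** T' = mat 1" by (simp add: T)
  then have UU': "U ** U' = mat 1" by (simp add: U_def U'_def matrix_mul_assoc)
  have inv: "matrix_inv U = U'" by (rule matrix_inv_eqI[OF UU'])
  have "\<phi> X = (T ** T') ** \<phi> X ** (T ** T')" for X by (simp add: T)
  then have \<phi>: "\<phi> X = T ** \<phi>1 X ** T'" for X by (simp add: \<phi>1_def matrix_mul_assoc)
  have "T ** mat_smult c (diag_mat t ** M ** diag_mat (\<lambda>i. inverse (t i))) ** T' = mat_smult c (U ** M ** matrix_inv U)" for c M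
    unfolding inv by (simp add: U_def U'_def mult_mat_smult mat_smult_mult matrix_mul_assoc)
  then have "(\<forall>X. \<phi> X = mat_smult f.\<epsilon> (U ** map_matrix \<omega> X ** matrix_inv U)) \<or>
     (\<forall>X. \<phi> X = mat_smult f.\<epsilon> (U ** transpose (map_matrix \<omega> X) ** matrix_inv U))"
    using form by (auto simp: \<phi>)
  moreover have "invertible U" using UU' invertible_right_inverse by blast
  ultimately show ?thesis using that \<omega> f.\<epsilon>_pow by blast
qed

section \<open>The converse direction and additivity\<close>

lemma additive_matrix_map:
  assumes "\<And>A B. g (A + B) = g A + g B"
    and "\<And>X. \<phi> X = mat_smult \<epsilon> (T ** g X ** (S::'a::field^'n^'n))"
  shows "Modules.additive \<phi>"
  by (unfold_locales) (simp add: assms matrix_add_ldistrib matrix_mult_add_rdistrib mat_smult_add)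

text \<open>The scalar disappears from the power because \<open>\<epsilon> ^ k = 1\<close>, so
  exactly one factor \<epsilon>, from the right operand, remains. Here \<open>g\<close> stands for
  the entrywise map with or without transposition.\<close>

lemma similar_jordan_power_map:
  fixes g :: "'a::field^'n^'n \<Rightarrow> 'a^'n^'n" and T :: "'a^'n^'n"
  assumes T: "invertible T" and \<epsilon>: "\<epsilon> ^ k = 1"
    and \<phi>: "\<And>X. \<phi> X = mat_smult \<epsilon> (T ** g X ** matrix_inv T)"
    and pow: "\<And>A. g (mat_pow A k) = mat_pow (g A) k"
    and jordan: "\<And>A B. g (jordan_prod A B) = jordan_prod (g A) (g B)"
  shows "\<phi> (jordan_prod (mat_pow A k) B) = jordan_prod (mat_pow (\<phi> A) k) (\<phi> B)"
proof -
  obtain T' where T': "T ** T' = mat 1" "T' ** T = mat 1" using T unfolding invertible_def by blast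
  have inv: "matrix_inv T = T'" by (rule matrix_inv_eqI[OF T'(1)])
  have "mat_pow (\<phi> A) k = T ** mat_pow (g A) k ** T'"
    by (simp add: \<phi> inv mat_pow_mat_smult \<epsilon> mat_pow_similar[OF T'(2,1)])
  then show ?thesis
    by (simp add: \<phi> inv jordan_prod_mat_smult jordan_prod_similar[OF T'(2)] jordan pow)
qed

lemma ring_monomorphism_sum:
  assumes "ring_monomorphism \<omega>"
  shows "\<omega> (sum h A) = (\<Sum>a\<in>A. \<omega> (h a))"
proof -
  have add: "\<omega> (x + y) = \<omega> x + \<omega> y" for x y using assms by (simp add: ring_monomorphism_def)
  have "\<omega> 0 = 0" using add[of 0 0] by simp
  then show ?thesis by (induction A rule: infinite_finite_induct) (simp_all add: add)
qed

context
  fixes \<omega> :: "'a::field \<Rightarrow> 'a"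
  assumes mono: "ring_monomorphism \<omega>" and two_neq_0: "(2::'a) \<noteq> 0"
begin

lemma map_matrix_add: "map_matrix \<omega> (A + B) = map_matrix \<omega> A + map_matrix \<omega> B"
  using mono by (simp add: matrix_eq_iff ring_monomorphism_def)

lemma map_matrix_mult: "map_matrix \<omega> (A ** B) = map_matrix \<omega> A ** map_matrix \<omega> B"
  using mono by (simp add: matrix_eq_iff matrix_mult_nth ring_monomorphism_sum[OF mono])
    (simp add: ring_monomorphism_def)

lemma map_matrix_mat_pow: "map_matrix \<omega> (mat_pow A m) = mat_pow (map_matrix \<omega> A) m"
proof (induction m)
  case 0
  have "\<omega> 0 = 0" using ring_monomorphism_sum[OF mono, of _ "{}"] by simp
  then show ?case using mono by (simp add: matrix_eq_iff mat_def ring_monomorphism_def)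
qed (simp add: map_matrix_mult)

text \<open>A ring monomorphism fixes 2, hence 1/2, so the normalising factor is respected.\<close>

lemma map_matrix_jordan_prod:
  fixes A B :: "'a^'n^'n"
  shows "map_matrix \<omega> (jordan_prod A B) = jordan_prod (map_matrix \<omega> A) (map_matrix \<omega> B)"
proof -
  have "\<omega> 2 = 2" using mono unfolding ring_monomorphism_def by (metis one_add_one)
  moreover have "\<omega> (1 / 2 * 2) = \<omega> (1 / 2) * \<omega> 2" using mono unfolding ring_monomorphism_def by blast
  moreover have "\<omega> (1 / 2 * 2) = 1" using mono two_neq_0 by (simp add: ring_monomorphism_def)
  ultimately have half: "\<omega> (1 / 2) = 1 / 2" using two_neq_0 by (simp add: field_simps)
  have "map_matrix \<omega> (mat_smult (1 / 2) M) = mat_smult (1 / 2) (map_matrix \<omega> M)" for M :: "'a^'n^'n"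
  proof -
    have "\<omega> (1 / 2 * x) = 1 / 2 * \<omega> x" for x
      using mono half unfolding ring_monomorphism_def by metis
    then show ?thesis by (simp only: matrix_eq_iff nth_map_matrix mat_smult_nth simp_thms)
  qed
  then show ?thesis by (simp only: jordan_prod_def map_matrix_add map_matrix_mult)
qed

end

lemma transpose_add: "transpose (A + B) = transpose A + transpose B"
  by (simp add: matrix_eq_iff transpose_def)

lemma transpose_mat_pow: "transpose (mat_pow A m) = mat_pow (transpose (A::'a::field^'n^'n)) m"
  by (induction m) (simp_all add: matrix_transpose_mul mat_pow_commute_matrix)

text \<open>Transposition reverses products, and the Jordan product is symmetric.\<close>

lemma transpose_jordan_prod:
  "transpose (jordan_prod A B) = jordan_prod (transpose A) (transpose (B::'a::field^'n^'n))"
proof -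
  have "transpose (mat_smult c M) = mat_smult c (transpose M)" for c and M :: "'a^'n^'n"
    by (simp add: matrix_eq_iff transpose_def)
  then show ?thesis by (simp add: jordan_prod_def transpose_add matrix_transpose_mul add.commute)
qed

lemma two_neq_0_if_CHAR:
  assumes "CHAR('a::idom) \<noteq> 2"
  shows "(2::'a) \<noteq> 0"
proof
  assume "(2::'a) = 0"
  then have "of_nat 2 = (0::'a)" by simp
  then have "CHAR('a) dvd 2" by (simp only: of_nat_eq_0_iff_char_dvd)
  then have "CHAR('a) = 1 \<or> CHAR('a) = 2" by (metis two_is_prime_nat prime_nat_iff)
  then show False using assms CHAR_not_1' by auto
qed

theorem theorem1p1:
  fixes \<phi> :: "'a::alg_closed_field^'n^'n \<Rightarrow> 'a^'n^'n"
    and k :: nat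
  assumes char_ne_2: "CHAR('a) \<noteq> 2"
    and n_ge_2: "2 \<le> CARD('n)"
    and k_pos: "0 < k"
  shows "((\<forall>A B. \<phi> (jordan_prod (mat_pow A k) B) = jordan_prod (mat_pow (\<phi> A) k) (\<phi> B)) \<longleftrightarrow>
           (\<exists>Q. mat_pow Q (k + 1) = Q \<and> (\<forall>X. \<phi> X = Q)) \<or>
           (\<exists>(T :: 'a^'n^'n) (\<omega> :: 'a \<Rightarrow> 'a) (\<epsilon> :: 'a). invertible T \<and> ring_monomorphism \<omega> \<and> \<epsilon> ^ k = 1 \<and>
             ((\<forall>X. \<phi> X = mat_smult \<epsilon> (T ** map_matrix \<omega> X ** matrix_inv T)) \<or>
              (\<forall>X. \<phi> X = mat_smult \<epsilon> (T ** transpose (map_matrix \<omega> X) ** matrix_inv T)))))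
       \<and> ((\<forall>A B. \<phi> (jordan_prod (mat_pow A k) B) = jordan_prod (mat_pow (\<phi> A) k) (\<phi> B)) \<and>
           \<not> \<phi> constant_on UNIV \<longrightarrow> Modules.additive \<phi>)"
    (is "(?eq \<longleftrightarrow> ?const \<or> ?form) \<and> (?eq \<and> _ \<longrightarrow> _)")
proof -
  have two: "(2::'a) \<noteq> 0" using char_ne_2 by (rule two_neq_0_if_CHAR)
  have const: "jordan_prod (mat_pow Q k) Q = mat_pow Q (k + 1)" for Q :: "'a^'n^'n"
    using two mat_pow_Suc_right[of Q k] by (simp add: matrix_eq_iff jordan_prod_nth)
  \<comment> \<open>Nonconstancy is expressed by a value different from the one at 0, matching
    \<open>zero_fibre\<close>.\<close>
  have nonconst: ?form if ?eq and "\<phi> X0 \<noteq> \<phi> 0" for X0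
  proof -
    interpret jordan_power_map \<phi> k
      using two n_ge_2 k_pos that(1) by unfold_locales auto
    have "X0 \<notin> zero_fibre" using that(2) by (simp add: zero_fibre_def)
    then obtain T \<omega> \<epsilon> where "invertible (T :: 'a^'n^'n)" "ring_monomorphism \<omega>" "\<epsilon> ^ k = 1"
      "(\<forall>X. \<phi> X = mat_smult \<epsilon> (T ** map_matrix \<omega> X ** matrix_inv T)) \<or>
       (\<forall>X. \<phi> X = mat_smult \<epsilon> (T ** transpose (map_matrix \<omega> X) ** matrix_inv T))"
      using nonconstant_form by blast
    then show ?form by (intro exI conjI)
  qed
  have "?const \<or> ?form" if ?eq
  proof (cases "\<forall>X. \<phi> X = \<phi> 0")
    case True
    then have "jordan_prod (mat_pow (\<phi> 0) k) (\<phi> 0) = \<phi> 0" using that by metis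
    then have "mat_pow (\<phi> 0) (k + 1) = \<phi> 0 \<and> (\<forall>X. \<phi> X = \<phi> 0)" using True const[of "\<phi> 0"] by simp
    then show ?thesis by (intro disjI1 exI)
  next
    case False
    then obtain X0 where "\<phi> X0 \<noteq> \<phi> 0" by blast
    then show ?thesis using nonconst that by blast
  qed
  moreover have ?eq if ?const
  proof -
    from that obtain Q where Q: "mat_pow Q (k + 1) = Q \<and> (\<forall>X. \<phi> X = Q)" by (rule exE)
    then have "\<phi> X = Q" for X by simp
    then show ?thesis using const[of Q] Q by simp
  qed
  moreover have form_imp: "?eq \<and> Modules.additive \<phi>" if ?form
  proof -
    from that obtain T :: "'a^'n^'n" and \<omega> \<epsilon> where T: "invertible T" and \<omega>: "ring_monomorphism \<omega>" and \<epsilon>: "\<epsilon> ^ k = 1"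
      and form: "(\<forall>X. \<phi> X = mat_smult \<epsilon> (T ** map_matrix \<omega> X ** matrix_inv T)) \<or>
        (\<forall>X. \<phi> X = mat_smult \<epsilon> (T ** transpose (map_matrix \<omega> X) ** matrix_inv T))"
      by (elim exE conjE)
    note map = map_matrix_add[OF \<omega> two] map_matrix_mat_pow[OF \<omega> two] map_matrix_jordan_prod[OF \<omega> two]
    from form show ?thesis
    proof
      assume 1: "\<forall>X. \<phi> X = mat_smult \<epsilon> (T ** map_matrix \<omega> X ** matrix_inv T)"
      have ?eq
        by (intro allI, rule similar_jordan_power_map[OF T \<epsilon>, of \<phi> "map_matrix \<omega>"]) (rule 1[rule_format] map)+
      moreover have "Modules.additive \<phi>"
        by (rule additive_matrix_map[of "map_matrix \<omega>"]) (rule 1[rule_format] map)+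
      ultimately show ?thesis by blast
    next
      assume 1: "\<forall>X. \<phi> X = mat_smult \<epsilon> (T ** transpose (map_matrix \<omega> X) ** matrix_inv T)"
      have ?eq
        by (intro allI, rule similar_jordan_power_map[OF T \<epsilon>, of \<phi> "\<lambda>X. transpose (map_matrix \<omega> X)"])
          (rule 1[rule_format], simp_all only: map transpose_mat_pow transpose_jordan_prod)
      moreover have "Modules.additive \<phi>"
        by (rule additive_matrix_map[of "\<lambda>X. transpose (map_matrix \<omega> X)"])
          (simp only: map transpose_add, rule 1[rule_format])
      ultimately show ?thesis by blast
    qed
  qed
  moreover have "Modules.additive \<phi>" if eq: ?eq and nc: "\<not> \<phi> constant_on UNIV"
  proof -
    obtain X0 where "\<phi> X0 \<noteq> \<phi> 0" using nc unfolding constant_on_def by blast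
    then show ?thesis using nonconst[OF eq] form_imp by blast
  qed
  ultimately show ?thesis by blast
qed

end
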